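(* Suppose the arrival rate is constant, $\lambda(t)=\lambda>0$. Then the network is ergodic if and only if $\mathbb{E}[W]<\infty$, where $$\mathbb{E}[W]=\int_0^\infty\Big[1-G_{\mathbf{S}}\big(1-Q_1(\tau),\dots,1-Q_J(\tau)\big)\Big]\,d\tau$$ is the expected time for which at least one customer of a given batch is present in the network.
   Context: Consider an open network of $J$ infinite server queues, indexed $1,\dots,J$, empty at time $0$. Batches arrive at the points $T_1,T_2,\dots$ of a homogeneous Poisson process on $[0,\infty)$ with rate $\lambda>0$. At time $T_i$, $\Sigma_{ij}$ customers arrive at queue $j$, for $j=1,\dots,J$. The vectors $\mathbf{\Sigma}_i=(\Sigma_{i1},\dots,\Sigma_{iJ})$, with non-negative integer components, are i.i.d. (and independent of the arrival times), with the same distribution as a generic vector $\mathbf{S}=(S_1,\dots,S_J)$ having probability generating function $G_{\mathbf{S}}(z_1,\dots,z_J)=\mathbb{E}\big[\prod_{j=1}^J z_j^{S_j}\big]$. The $\ell$th customer entering queue $j$ at time $T_i$ carries a stochastic process $X^j_{i,\ell}(t)$, $t\ge 0$, where $X^j_{i,\ell}(t)=k\in\{1,\dots,J\}$ means that the customer is in queue $k$ at time $T_i+t$ (and $X^j_{i,\ell}(t)\notin\{1,\dots,J\}$ if the customer has left the network; customers that have left do not return). These processes are mutually independent and independent of the arrival times and batch sizes (conditionally on the node of entry), with $P(X^j_{i,\ell}(t)=k)=q^j_k(t)$ (measurable in $t$). Put $Q_j(t)=\sum_{k=1}^J q^j_k(t)$, the probability that a customer who entered at queue $j$ is still in the network a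 time $t$ after arrival. $W$ is the time for which at least one customer of a given batch is present somewhere in the network. $\mathbf{N}(t)=(N_1(t),\dots,N_J(t))$ is the vector of numbers of customers in each queue at time $t$. The network is called ergodic if, as $t\to\infty$, $\mathbf{N}(t)$ converges in distribution to a proper probability distribution on $\mathbb{Z}_{\ge 0}^J$. *)

theory Defs
  imports "HOL-Probability.Probability"
begin

text \<open>
  The queues are the elements of a finite type \<open>'j\<close> (so J is the cardinality of \<open>'j\<close>); batches
  and the customers within a batch are numbered from 0.  The position of a customer is an element
  of \<open>'j option\<close>, with \<open>None\<close> meaning that the customer has left the network.
\<close>

text \<open>
  \<open>T 0, T 1, \<dots>\<close> are the successive points of a homogeneous Poisson point process of rate \<open>lam\<close> on
  \<open>[0, \<infinity>)\<close>.  The Poisson probabilities are written out because the library's \<open>poisson_pmf\<close> is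
  specified for positive parameters only, whereas null sets have parameter 0.  Finite families of
  disjoint sets are covered by padding with empty sets.
\<close>

definition (in prob_space) poisson_points :: "real \<Rightarrow> (nat \<Rightarrow> 'a \<Rightarrow> real) \<Rightarrow> bool" where
  "poisson_points lam T \<longleftrightarrow>
     (\<forall>i. random_variable borel (T i)) \<and>
     (AE \<omega> in M. \<forall>i. 0 \<le> T i \<omega> \<and> T i \<omega> \<le> T (Suc i) \<omega>) \<and>
     (AE \<omega> in M. \<forall>t. finite {i. T i \<omega> \<le> t}) \<and>
     (\<forall>A n. A \<in> sets borel \<longrightarrow> bounded A \<longrightarrow> A \<subseteq> {0..} \<longrightarrow>
        prob {\<omega> \<in> space M. card {i. T i \<omega> \<in> A} = n}
          = (lam * measure lborel A) ^ n / fact n * exp (- (lam * measure lborel A))) \<and>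
     (\<forall>A :: nat \<Rightarrow> real set. (\<forall>m. A m \<in> sets borel \<and> bounded (A m) \<and> A m \<subseteq> {0..}) \<longrightarrow>
        disjoint_family A \<longrightarrow>
        indep_vars (\<lambda>_. count_space UNIV) (\<lambda>m \<omega>. card {i. T i \<omega> \<in> A m}) UNIV)"

datatype 'j source = Arrivals | Batch nat | Customer nat 'j nat

definition process_algebra :: "'a measure \<Rightarrow> ('a \<Rightarrow> real \<Rightarrow> 'b) \<Rightarrow> 'a measure" where
  "process_algebra M Y =
     vimage_algebra (space M) (\<lambda>\<omega>. \<lambda>t\<in>{0..}. Y \<omega> t) (Pi\<^sub>M {0..} (\<lambda>_. count_space UNIV))"

fun source_algebra ::
  "'a measure \<Rightarrow> (nat \<Rightarrow> 'a \<Rightarrow> real) \<Rightarrow> (nat \<Rightarrow> 'a \<Rightarrow> nat ^ 'j) \<Rightarrow>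
   (nat \<Rightarrow> 'j \<Rightarrow> nat \<Rightarrow> 'a \<Rightarrow> real \<Rightarrow> 'j option) \<Rightarrow> 'j source \<Rightarrow> 'a measure" where
  "source_algebra M T B X Arrivals =
     vimage_algebra (space M) (\<lambda>\<omega> i. T i \<omega>) (Pi\<^sub>M UNIV (\<lambda>_. borel))"
| "source_algebra M T B X (Batch i) = vimage_algebra (space M) (B i) (count_space UNIV)"
| "source_algebra M T B X (Customer i j l) = process_algebra M (X i j l)"

text \<open>
  \<open>B i $ j\<close> is the number of customers that batch \<open>i\<close> brings to queue \<open>j\<close>; \<open>X i j l \<omega> t\<close> is the
  position, a time \<open>t\<close> after arrival, of customer \<open>l\<close> among those of batch \<open>i\<close> entering at queue
  \<open>j\<close>; \<open>q j k t\<close> is the probability that this position is queue \<open>k\<close>.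

  Assumption \<open>process_measurable\<close> makes evaluation at the random times \<open>t - T i\<close> meaningful: each
  customer process is a measurable process for the sigma-algebra it generates itself (right-continuous
  processes, for instance, are).  Joint measurability for \<open>M\<close> only would not do: a customer who
  stays in one queue except that at time \<open>s - T i\<close>, for a fixed \<open>s\<close>, it is in another queue
  has a jointly measurable process whose values at fixed times are almost surely constant, hence
  independent of \<open>T i\<close>, although at real time \<open>s\<close> it is always in the other queue.
\<close>

locale batch_network = prob_space M
  for M :: "'a measure" +
  fixes lam :: real
    and T :: "nat \<Rightarrow> 'a \<Rightarrow> real"
    and S :: "(nat ^ 'j::finite) pmf"
    and B :: "nat \<Rightarrow> 'a \<Rightarrow> nat ^ 'j"
    and X :: "nat \<Rightarrow> 'j \<Rightarrow> nat \<Rightarrow> 'a \<Rightarrow> real \<Rightarrow> 'j option"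
    and q :: "'j \<Rightarrow> 'j \<Rightarrow> real \<Rightarrow> real"
  assumes rate_pos: "0 < lam"
    and arrivals: "poisson_points lam T"
    and batch_distr: "\<And>i. distr M (count_space UNIV) (B i) = measure_pmf S"
    and process_measurable: "\<And>i j l. (\<lambda>(\<omega>, t). X i j l \<omega> t) \<in>
          process_algebra M (X i j l) \<Otimes>\<^sub>M restrict_space borel {0..} \<rightarrow>\<^sub>M count_space UNIV"
    and position_prob: "\<And>i j l k t. 0 \<le> t \<Longrightarrow> prob {\<omega> \<in> space M. X i j l \<omega> t = Some k} = q j k t"
    and q_measurable: "\<And>j k. q j k \<in> borel_measurable (restrict_space borel {0..})"
    and no_return: "AE \<omega> in M. \<forall>i j l s t. 0 \<le> s \<longrightarrow> s \<le> t \<longrightarrow>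
          X i j l \<omega> s = None \<longrightarrow> X i j l \<omega> t = None"
    and independence: "indep_sets (\<lambda>r. sets (source_algebra M T B X r)) UNIV"

definition pgf :: "(nat ^ 'j::finite) pmf \<Rightarrow> real ^ 'j \<Rightarrow> real" where
  "pgf S z = measure_pmf.expectation S (\<lambda>s. \<Prod>j\<in>UNIV. (z $ j) ^ (s $ j))"

definition stay_prob :: "('j::finite \<Rightarrow> 'j \<Rightarrow> real \<Rightarrow> real) \<Rightarrow> 'j \<Rightarrow> real \<Rightarrow> real" where
  "stay_prob q j t = (\<Sum>k\<in>UNIV. q j k t)"

definition queue_lengths ::
  "(nat \<Rightarrow> 'a \<Rightarrow> real) \<Rightarrow> (nat \<Rightarrow> 'a \<Rightarrow> nat ^ 'j::finite) \<Rightarrow>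
   (nat \<Rightarrow> 'j \<Rightarrow> nat \<Rightarrow> 'a \<Rightarrow> real \<Rightarrow> 'j option) \<Rightarrow> real \<Rightarrow> 'a \<Rightarrow> nat ^ 'j" where
  "queue_lengths T B X t \<omega> =
     (\<chi> k. card {(i, j, l). T i \<omega> \<le> t \<and> l < B i \<omega> $ j \<and> X i j l \<omega> (t - T i \<omega>) = Some k})"

definition presence_time ::
  "(nat \<Rightarrow> 'a \<Rightarrow> nat ^ 'j::finite) \<Rightarrow> (nat \<Rightarrow> 'j \<Rightarrow> nat \<Rightarrow> 'a \<Rightarrow> real \<Rightarrow> 'j option) \<Rightarrow>
   nat \<Rightarrow> 'a \<Rightarrow> ennreal" where
  "presence_time B X i \<omega> =
     emeasure lborel {t. 0 \<le> t \<and> (\<exists>j l. l < B i \<omega> $ j \<and> X i j l \<omega> t \<noteq> None)}"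

definition converges_in_distribution ::
  "'a measure \<Rightarrow> (real \<Rightarrow> 'a \<Rightarrow> 'b::topological_space) \<Rightarrow> 'b measure \<Rightarrow> bool" where
  "converges_in_distribution M Y L \<longleftrightarrow>
     (\<forall>f :: 'b \<Rightarrow> real. continuous_on UNIV f \<longrightarrow> bounded (range f) \<longrightarrow>
        ((\<lambda>t. \<integral>\<omega>. f (Y t \<omega>) \<partial>M) \<longlongrightarrow> (\<integral>y. f y \<partial>L)) at_top)"

text \<open>
  The topology on \<open>nat ^ 'j\<close> is the discrete one, and a \<open>pmf\<close> has total mass 1, so that no mass
  of the limit escapes to infinity.
\<close>

definition ergodic ::
  "'a measure \<Rightarrow> (nat \<Rightarrow> 'a \<Rightarrow> real) \<Rightarrow> (nat \<Rightarrow> 'a \<Rightarrow> nat ^ 'j::finite) \<Rightarrow>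
   (nat \<Rightarrow> 'j \<Rightarrow> nat \<Rightarrow> 'a \<Rightarrow> real \<Rightarrow> 'j option) \<Rightarrow> bool" where
  "ergodic M T B X \<longleftrightarrow>
     (\<exists>p :: (nat ^ 'j) pmf. converges_in_distribution M (queue_lengths T B X) (measure_pmf p))"

end

theory Submission
  imports Defs
begin

text \<open>
  The generating function of the queue lengths at time \<open>t\<close> is explicit. Let \<open>batch_pgf z \<tau>\<close> be
  the generating function of the numbers of customers of one batch in the various queues, a time
  \<open>\<tau>\<close> after its arrival. By independence, given the arrival times, the queue lengths have the
  generating function \<open>\<Prod>i. batch_pgf z (t - T i)\<close>, the product being over the arrivals up to
  time \<open>t\<close>, and the generating functional of the Poisson process (\<open>poisson_functional\<close>) gives

  \<open>E \<Prod>k. z k ^ N k t = exp (- lam \<integral>\<^bsub>[0, t]\<^esub> (1 - batch_pgf z \<tau>) d\<tau>)\<close>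

  (\<open>queue_lengths_pgf\<close>). At \<open>z = 0\<close> the integrand \<open>1 - batch_pgf 0 \<tau>\<close> is the probability that
  some customer of the batch is present at age \<open>\<tau>\<close>, so its integral over all ages is the
  expected presence time \<open>E W\<close> (\<open>expected_presence_time\<close>).

  If \<open>E W\<close> is finite, it dominates the exponents for all \<open>z\<close> in the unit cube. The generating
  functions therefore converge, to a limit that is continuous at \<open>z = 1\<close> along the diagonal, and
  a continuity theorem for multivariate generating functions (\<open>pgf_continuity\<close>) provides the
  limit distribution (\<open>ergodic_if_finite\<close>). Conversely, at \<open>z = 1/2\<close> in all coordinates the
  integrand is at least half of that at \<open>z = 0\<close>. If \<open>E W\<close> were infinite, the generating function
  at \<open>z = 1/2\<close>, and hence every point probability, would tend to 0, and all mass would escape to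
  infinity (\<open>finite_if_ergodic\<close>).
\<close>

section \<open>The generating functional of a Poisson process\<close>

lemma (in prob_space) expectation_power_poisson:
  fixes K :: "'a \<Rightarrow> nat"
  assumes K[measurable]: "random_variable (count_space UNIV) K"
    and poisson: "\<And>n. prob {\<omega> \<in> space M. K \<omega> = n} = \<mu> ^ n / fact n * exp (- \<mu>)"
    and x: "0 \<le> x" "x \<le> 1"
  shows "expectation (\<lambda>\<omega>. x ^ K \<omega>) = exp (- (\<mu> * (1 - x)))"
proof -
  define E where "E n = {\<omega> \<in> space M. K \<omega> = n}" for n
  have E: "E n \<in> events" "E n \<inter> space M = E n" for n
    by (auto simp: E_def)
  let ?f = "\<lambda>n \<omega>. x ^ n * indicator (E n) \<omega> :: real"
  have term_sums: "(\<lambda>n. ?f n \<omega>) sums x ^ K \<omega>" if "\<omega> \<in> space M" for \<omega>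
  proof -
    have "?f n \<omega> = (if n = K \<omega> then x ^ n else 0)" for n using that by (auto simp: E_def)
    then show ?thesis using sums_single[of "K \<omega>" "\<lambda>n. x ^ n"] by simp
  qed
  have int: "integral\<^sup>L M (?f n) = (\<mu> * x) ^ n / fact n * exp (- \<mu>)" for n
    using poisson[of n] E by (simp add: E_def[symmetric] power_mult_distrib)
  have "(\<lambda>n. (\<mu> * x) ^ n / fact n) sums exp (\<mu> * x)"
    using exp_converges[of "\<mu> * x"] by (simp add: scaleR_conv_of_real field_simps)
  from sums_mult2[OF this, of "exp (- \<mu>)"]
  have exp_sums: "(\<lambda>n. integral\<^sup>L M (?f n)) sums exp (- (\<mu> * (1 - x)))"
    unfolding int by (simp add: exp_add[symmetric] algebra_simps)
  have "(\<lambda>n. integral\<^sup>L M (?f n)) sums (\<integral>\<omega>. (\<Sum>n. ?f n \<omega>) \<partial>M)"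
  proof (rule sums_integral)
    show "integrable M (?f n)" for n
      by (intro integrable_mult_right integrable_real_indicator E) (simp add: less_top[symmetric])
    show "AE \<omega> in M. summable (\<lambda>n. norm (?f n \<omega>))"
      using term_sums x by (auto intro!: AE_I2 simp: abs_mult dest!: sums_summable)
    have "(\<lambda>n. \<integral>\<omega>. norm (?f n \<omega>) \<partial>M) = (\<lambda>n. integral\<^sup>L M (?f n))"
      using x by (simp add: abs_mult)
    then show "summable (\<lambda>n. \<integral>\<omega>. norm (?f n \<omega>) \<partial>M)"
      using exp_sums by (simp add: sums_summable del: real_norm_def)
  qed
  moreover have "(\<integral>\<omega>. (\<Sum>n. ?f n \<omega>) \<partial>M) = expectation (\<lambda>\<omega>. x ^ K \<omega>)"
    using term_sums by (intro Bochner_Integration.integral_cong) (auto simp: sums_iff)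
  ultimately show ?thesis using exp_sums sums_unique2 by metis
qed

text \<open>
  The values \<open>floor (2^n x) / 2^n\<close> discretise a function with values in the unit interval into
  one with finitely many values, to which the Poisson counts on the level sets can be applied.
\<close>

lemma dyadic_floor_tendsto: "(\<lambda>n. real_of_int \<lfloor>2 ^ n * x\<rfloor> / 2 ^ n) \<longlonglongrightarrow> (x :: real)"
proof (rule tendsto_sandwich)
  show "\<forall>\<^sub>F n in sequentially. x - (1 / 2) ^ n \<le> real_of_int \<lfloor>2 ^ n * x\<rfloor> / 2 ^ n"
  proof (rule always_eventually, rule allI)
    fix n
    have "2 ^ n * x - 1 \<le> real_of_int \<lfloor>2 ^ n * x\<rfloor>" by linarith
    then have "(2 ^ n * x - 1) / 2 ^ n \<le> real_of_int \<lfloor>2 ^ n * x\<rfloor> / 2 ^ n" by (intro divide_right_mono) auto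
    then show "x - (1 / 2) ^ n \<le> real_of_int \<lfloor>2 ^ n * x\<rfloor> / 2 ^ n"
      by (simp add: diff_divide_distrib power_one_over)
  qed
  show "\<forall>\<^sub>F n in sequentially. real_of_int \<lfloor>2 ^ n * x\<rfloor> / 2 ^ n \<le> x"
    by (intro always_eventually allI) (simp add: pos_divide_le_eq mult.commute)
  have "(\<lambda>n. x - (1 / 2) ^ n) \<longlonglongrightarrow> x - 0"
    by (intro tendsto_intros LIMSEQ_realpow_zero) auto
  then show "(\<lambda>n. x - (1 / 2) ^ n) \<longlonglongrightarrow> x" by simp
qed simp

lemma power_card_filter:
  assumes "finite I"
  shows "(x :: 'a::comm_monoid_mult) ^ card {i \<in> I. P i} = (\<Prod>i\<in>I. if P i then x else 1)"
  using assms by (simp add: prod.inter_filter[symmetric])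

text \<open>
  The probability generating functional of a Poisson process,
  \<open>E \<Prod>i. h (T i) = exp (- lam \<integral> (1 - h))\<close>. If \<open>h\<close> takes finitely many values, the product is
  \<open>\<Prod>k. c k ^ (number of points in the k-th level set)\<close>, a product of independent powers with
  Poisson exponents. The general case follows by dominated convergence on both sides. The
  product over the random finite set of points in \<open>[0, t]\<close> is written as a limit of products
  over the first \<open>n\<close> indices: this is the form in which independence is applied later, and its
  measurability is immediate.
\<close>

lemma (in prob_space) poisson_functional:
  fixes h :: "real \<Rightarrow> real"
  assumes T: "poisson_points lam T"
    and h[measurable]: "h \<in> borel_measurable borel" and h01: "\<And>s. 0 \<le> h s" "\<And>s. h s \<le> 1"
  shows "(\<lambda>n. expectation (\<lambda>\<omega>. \<Prod>i<n. if T i \<omega> \<le> t then h (T i \<omega>) else 1))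
    \<longlonglongrightarrow> exp (- (lam * (LBINT s:{0..t}. 1 - h s)))"
proof -
  note T' = T[unfolded poisson_points_def]
  have T_measurable[measurable]: "random_variable borel (T i)" for i
    using T' by blast
  have pos: "AE \<omega> in M. \<forall>i. 0 \<le> T i \<omega>"
    using T'[THEN conjunct2, THEN conjunct1] by eventually_elim blast
  have fin: "AE \<omega> in M. finite {i. T i \<omega> \<le> t}"
    using T'[THEN conjunct2, THEN conjunct2, THEN conjunct1] by eventually_elim blast
  have poisson: "prob {\<omega> \<in> space M. card {i. T i \<omega> \<in> D} = n}
      = (lam * measure lborel D) ^ n / fact n * exp (- (lam * measure lborel D))"
    if "D \<in> sets borel" "bounded D" "D \<subseteq> {0..}" for D n
    using T' that by blast
  have indep_counts: "indep_vars (\<lambda>_. count_space UNIV) (\<lambda>m \<omega>. card {i. T i \<omega> \<in> A m}) UNIV"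
    if "\<And>m. A m \<in> sets borel" "\<And>m. bounded (A m)" "\<And>m. A m \<subseteq> {0..}" "disjoint_family A"
    for A :: "nat \<Rightarrow> real set"
    using T' that by blast
  have real_le_two_power: "real k \<le> 2 ^ m" if "k \<le> 2 ^ m" for k m :: nat
    using of_nat_mono[OF that, where ?'a = real] by simp
  \<comment> \<open>\<open>a m\<close> is \<open>h\<close> rounded down to a multiple of \<open>2^(-m)\<close>, and the \<open>D m k\<close> are its level
      sets in \<open>[0, t]\<close>.\<close>
  define f where "f m s = nat \<lfloor>2 ^ m * h s\<rfloor>" for m s
  define a where "a m s = real (f m s) / 2 ^ m" for m s
  define D where "D m k = {s \<in> {0..t}. f m s = k}" for m k
  define Y where "Y m \<omega> = (\<Prod>k\<le>2 ^ m. (real k / 2 ^ m) ^ card {i. T i \<omega> \<in> D m k})" for m \<omega>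
  \<comment> \<open>Almost surely only finitely many factors differ from 1, so the products are eventually
      constant in \<open>n\<close>.\<close>
  define Z where "Z \<omega> = lim (\<lambda>n. \<Prod>i<n. if T i \<omega> \<le> t then h (T i \<omega>) else 1)" for \<omega>
  have f_measurable[measurable]: "f m \<in> borel \<rightarrow>\<^sub>M count_space UNIV" for m
    unfolding f_def by measurable
  have D_sets[measurable]: "D m k \<in> sets borel" for m k
    unfolding D_def by measurable
  have D_sub: "D m k \<subseteq> {0..t}" for m k by (auto simp: D_def)
  have D_bounded: "bounded (D m k)" for m k
    using bounded_closed_interval D_sub by (rule bounded_subset)
  have f_le: "f m s \<le> 2 ^ m" for m s
  proof -
    have "2 ^ m * h s \<le> 2 ^ m * 1" using h01 by (intro mult_left_mono) auto
    then have "\<lfloor>2 ^ m * h s\<rfloor> \<le> \<lfloor>2 ^ m :: real\<rfloor>" by (intro floor_mono) simp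
    also have "\<lfloor>2 ^ m :: real\<rfloor> = 2 ^ m" by (metis floor_numeral_power)
    finally show ?thesis unfolding f_def by (simp add: nat_le_iff)
  qed
  have a01: "0 \<le> a m s" "a m s \<le> 1" for m s
    using real_le_two_power[OF f_le] by (auto simp: a_def divide_le_eq)
  have a_lim: "(\<lambda>m. a m s) \<longlonglongrightarrow> h s" for s
    using dyadic_floor_tendsto[of "h s"] h01 by (simp add: a_def f_def)
  have a_measurable[measurable]: "a m \<in> borel_measurable borel" for m
    unfolding a_def by measurable
  have card_measurable[measurable]: "(\<lambda>\<omega>. card {i. T i \<omega> \<in> D m k}) \<in> M \<rightarrow>\<^sub>M count_space UNIV" for m k
    by measurable
  have Y_measurable[measurable]: "Y m \<in> borel_measurable M" for m
    unfolding Y_def by measurable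
  have Y01: "0 \<le> Y m \<omega>" "Y m \<omega> \<le> 1" for m \<omega>
    unfolding Y_def
    by (auto intro!: prod_nonneg prod_le_1 power_le_one simp: divide_le_eq real_le_two_power)
  have product_limit: "(\<lambda>n. \<Prod>i<n. if T i \<omega> \<le> t then h (T i \<omega>) else 1) \<longlonglongrightarrow> (\<Prod>i | T i \<omega> \<le> t. h (T i \<omega>))"
    if "finite {i. T i \<omega> \<le> t}" for \<omega>
  proof -
    from that obtain N where N: "{i. T i \<omega> \<le> t} \<subseteq> {..<N}" by (metis finite_nat_iff_bounded)
    have "(\<Prod>i<n. if T i \<omega> \<le> t then h (T i \<omega>) else 1) = (\<Prod>i | T i \<omega> \<le> t. h (T i \<omega>))" if "N \<le> n" for n
      using N that by (intro prod.mono_neutral_cong_right) auto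
    then show ?thesis by (intro tendsto_eventually) (auto simp: eventually_sequentially)
  qed
  have Z_eq: "Z \<omega> = (\<Prod>i | T i \<omega> \<le> t. h (T i \<omega>))" if "finite {i. T i \<omega> \<le> t}" for \<omega>
    unfolding Z_def by (rule limI[OF product_limit[OF that]])
  have Z_measurable[measurable]: "Z \<in> borel_measurable M"
    unfolding Z_def by measurable
  have "(\<lambda>n. expectation (\<lambda>\<omega>. \<Prod>i<n. if T i \<omega> \<le> t then h (T i \<omega>) else 1)) \<longlonglongrightarrow> expectation Z"
  proof (rule integral_dominated_convergence[where w = "\<lambda>_. 1"])
    show "AE \<omega> in M. (\<lambda>n. \<Prod>i<n. if T i \<omega> \<le> t then h (T i \<omega>) else 1) \<longlonglongrightarrow> Z \<omega>"
      using fin by eventually_elim (simp add: Z_eq product_limit)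
    show "AE \<omega> in M. norm (\<Prod>i<n. if T i \<omega> \<le> t then h (T i \<omega>) else 1) \<le> 1" for n
      using h01 by (intro AE_I2) (auto simp: abs_prod intro!: prod_le_1)
  qed measurable
  moreover have Y_lim: "(\<lambda>m. expectation (Y m)) \<longlonglongrightarrow> expectation Z"
  proof (rule integral_dominated_convergence[where w = "\<lambda>_. 1"])
    show "AE \<omega> in M. (\<lambda>m. Y m \<omega>) \<longlonglongrightarrow> Z \<omega>"
      using fin pos
    proof eventually_elim
      case (elim \<omega>)
      let ?I = "{i. T i \<omega> \<le> t}"
      have "Y m \<omega> = (\<Prod>i\<in>?I. a m (T i \<omega>))" for m
      proof -
        have sets_eq: "{i. T i \<omega> \<in> D m k} = {i \<in> ?I. f m (T i \<omega>) = k}" for k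
          using elim by (auto simp: D_def)
        have "Y m \<omega> = (\<Prod>k\<le>2 ^ m. \<Prod>i\<in>?I. if f m (T i \<omega>) = k then real k / 2 ^ m else 1)"
          unfolding Y_def sets_eq using elim by (intro prod.cong refl power_card_filter) simp
        also have "\<dots> = (\<Prod>i\<in>?I. \<Prod>k\<le>2 ^ m. if f m (T i \<omega>) = k then real k / 2 ^ m else 1)"
          by (rule prod.swap)
        also have "\<dots> = (\<Prod>i\<in>?I. a m (T i \<omega>))"
          using f_le by (intro prod.cong refl) (simp add: a_def)
        finally show ?thesis .
      qed
      then show ?case
        using elim by (simp add: Z_eq) (intro tendsto_prod a_lim)
    qed
    show "AE \<omega> in M. norm (Y m \<omega>) \<le> 1" for m using Y01 by simp
  qed measurable
  moreover have Y_eq: "expectation (Y m) = exp (- (lam * (LBINT s:{0..t}. 1 - a m s)))" for m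
  proof -
    have "indep_vars (\<lambda>_. count_space UNIV) (\<lambda>k \<omega>. card {i. T i \<omega> \<in> D m k}) UNIV"
      using D_sets D_sub D_bounded by (intro indep_counts) (auto simp: disjoint_family_on_def D_def)
    then have "indep_vars (\<lambda>_. count_space UNIV) (\<lambda>k \<omega>. card {i. T i \<omega> \<in> D m k}) {..2 ^ m}"
      by (rule indep_vars_subset) auto
    then have indep: "indep_vars (\<lambda>_. borel) (\<lambda>k \<omega>. (real k / 2 ^ m) ^ card {i. T i \<omega> \<in> D m k}) {..2 ^ m}"
      by (rule indep_vars_compose2) auto
    have "expectation (Y m) = (\<Prod>k\<le>2 ^ m. expectation (\<lambda>\<omega>. (real k / 2 ^ m) ^ card {i. T i \<omega> \<in> D m k}))"
      unfolding Y_def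
      by (intro indep_vars_lebesgue_integral indep integrable_const_bound[where B = 1])
         (auto simp: power_le_one abs_of_nonneg divide_le_eq real_le_two_power)
    also have "\<dots> = (\<Prod>k\<le>2 ^ m. exp (- (lam * measure lborel (D m k) * (1 - real k / 2 ^ m))))"
    proof (intro prod.cong refl expectation_power_poisson poisson D_sets D_bounded)
      show "D m k \<subseteq> {0..}" for k using D_sub[of m k] by auto
    qed (auto simp: divide_le_eq real_le_two_power)
    also have "\<dots> = exp (- (lam * (\<Sum>k\<le>2 ^ m. (1 - real k / 2 ^ m) * measure lborel (D m k))))"
      by (simp add: exp_sum[symmetric] sum_negf sum_distrib_left ac_simps)
    also have "(\<Sum>k\<le>2 ^ m. (1 - real k / 2 ^ m) * measure lborel (D m k))
        = (\<Sum>k\<le>2 ^ m. LINT s|lborel. (1 - real k / 2 ^ m) * indicator (D m k) s)"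
      by simp
    also have "\<dots> = (LINT s|lborel. (\<Sum>k\<le>2 ^ m. (1 - real k / 2 ^ m) * indicator (D m k) s))"
    proof (intro Bochner_Integration.integral_sum[symmetric] integrable_mult_right integrable_real_indicator)
      show "emeasure lborel (D m k) < \<infinity>" for k
        using emeasure_mono[OF D_sub[of m k], of lborel]
        by (auto intro: le_less_trans simp: emeasure_lborel_Icc_eq)
    qed simp
    also have "\<dots> = (LBINT s:{0..t}. 1 - a m s)"
      unfolding set_lebesgue_integral_def
    proof (intro Bochner_Integration.integral_cong refl)
      fix s
      have "(\<Sum>k\<le>2 ^ m. (1 - real k / 2 ^ m) * indicator (D m k) s)
          = (\<Sum>k\<le>2 ^ m. if k = f m s then indicator {0..t} s * (1 - a m s) else 0)"
        by (intro sum.cong refl) (auto simp: D_def a_def split: split_indicator)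
      then show "(\<Sum>k\<le>2 ^ m. (1 - real k / 2 ^ m) * indicator (D m k) s) = indicator {0..t} s *\<^sub>R (1 - a m s)"
        using f_le by simp
    qed
    finally show ?thesis .
  qed
  moreover have "(\<lambda>m. exp (- (lam * (LBINT s:{0..t}. 1 - a m s)))) \<longlonglongrightarrow> exp (- (lam * (LBINT s:{0..t}. 1 - h s)))"
  proof -
    have "(\<lambda>m. LBINT s:{0..t}. 1 - a m s) \<longlonglongrightarrow> (LBINT s:{0..t}. 1 - h s)"
      unfolding set_lebesgue_integral_def
    proof (rule integral_dominated_convergence[where w = "indicator {0..t}"])
      show "AE s in lborel. (\<lambda>m. indicator {0..t} s *\<^sub>R (1 - a m s)) \<longlonglongrightarrow> indicator {0..t} s *\<^sub>R (1 - h s)"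
        by (intro AE_I2 tendsto_intros a_lim)
      show "AE s in lborel. norm (indicator {0..t} s *\<^sub>R (1 - a m s)) \<le> indicator {0..t} s" for m
        using a01 by (intro AE_I2) (auto split: split_indicator)
    qed (auto simp: emeasure_lborel_Icc_eq)
    then show ?thesis by (intro tendsto_intros)
  qed
  then have "expectation Z = exp (- (lam * (LBINT s:{0..t}. 1 - h s)))"
    using Y_lim unfolding Y_eq by (rule LIMSEQ_unique[rotated])
  ultimately show ?thesis by simp
qed

section \<open>A continuity theorem for probability generating functions\<close>

text \<open>
  Linear combinations of the functions \<open>n \<mapsto> \<Prod>j. z j ^ n j\<close>: the test functions whose
  expectations are determined by the generating function on the unit cube. They form an algebra
  because the product of two such functions belongs to the coordinatewise product of their
  parameters.
\<close>

inductive_set power_combinations :: "(nat ^ 'j::finite \<Rightarrow> real) set" where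
  power: "(\<And>j. 0 \<le> z $ j \<and> z $ j \<le> 1) \<Longrightarrow> (\<lambda>n. \<Prod>j\<in>UNIV. (z $ j) ^ (n $ j)) \<in> power_combinations"
| add: "f \<in> power_combinations \<Longrightarrow> g \<in> power_combinations \<Longrightarrow> (\<lambda>n. f n + g n) \<in> power_combinations"
| scale: "f \<in> power_combinations \<Longrightarrow> (\<lambda>n. c * f n) \<in> power_combinations"

lemma prod_power_le_1:
  fixes z :: "real ^ 'j::finite"
  assumes "\<And>j. 0 \<le> z $ j \<and> z $ j \<le> 1"
  shows "0 \<le> (\<Prod>j\<in>UNIV. (z $ j) ^ (n $ j))" "(\<Prod>j\<in>UNIV. (z $ j) ^ (n $ j)) \<le> 1"
  using assms by (auto intro!: prod_nonneg prod_le_1 power_le_one)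

lemma power_combinations_bounded:
  assumes "f \<in> power_combinations"
  shows "\<exists>C. \<forall>n. \<bar>f n\<bar> \<le> C"
  using assms
proof induction
  case (power z)
  then show ?case by (intro exI[of _ 1]) (simp add: prod_power_le_1 abs_of_nonneg)
next
  case (add f g)
  then obtain C D where "\<forall>n. \<bar>f n\<bar> \<le> C" "\<forall>n. \<bar>g n\<bar> \<le> D" by blast
  then show ?case by (intro exI[of _ "C + D"]) (auto intro: order_trans[OF abs_triangle_ineq] add_mono)
next
  case (scale f c)
  then obtain C where "\<forall>n. \<bar>f n\<bar> \<le> C" by blast
  then show ?case by (intro exI[of _ "\<bar>c\<bar> * C"]) (auto simp: abs_mult intro: mult_left_mono)
qed

lemma power_combinations_mult:
  assumes "f \<in> power_combinations" "g \<in> power_combinations"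
  shows "(\<lambda>n. f n * g n) \<in> power_combinations"
  using assms
proof (induction arbitrary: g)
  case (power z)
  from power(2) show ?case
  proof induction
    case (power y)
    have "(\<lambda>n. \<Prod>j\<in>UNIV. ((\<chi> j. z $ j * y $ j) $ j) ^ (n $ j)) \<in> power_combinations"
      using \<open>\<And>j. 0 \<le> z $ j \<and> z $ j \<le> 1\<close> power
      by (intro power_combinations.power) (auto intro: mult_le_one)
    then show ?case by (simp add: power_mult_distrib prod.distrib)
  next
    case (add g h)
    then show ?case using power_combinations.add[OF add.IH] by (simp add: distrib_left)
  next
    case (scale g c)
    then show ?case using power_combinations.scale[OF scale.IH, of c] by (simp add: ac_simps)
  qed
next
  case (add f h)
  then show ?case using power_combinations.add[OF add.IH(1,2)[OF add.prems]] by (simp add: distrib_right)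
next
  case (scale f c)
  then show ?case using power_combinations.scale[OF scale.IH[OF scale.prems], of c] by (simp add: ac_simps)
qed

lemma power_combinations_const: "(\<lambda>n :: nat ^ 'j::finite. c) \<in> power_combinations"
  using power_combinations.scale[OF power_combinations.power[of "1 :: real ^ 'j"], of c] by simp

lemma power_combinations_sum:
  assumes "finite I" "\<And>i. i \<in> I \<Longrightarrow> f i \<in> power_combinations"
  shows "(\<lambda>n. \<Sum>i\<in>I. f i n) \<in> power_combinations"
  using assms by (induction) (auto intro: power_combinations.add power_combinations_const)

text \<open>
  An injective map of \<open>nat ^ 'j\<close> onto a discrete subset of the compact cube. Its coordinates are
  themselves of the form \<open>\<Prod>j. z j ^ n j\<close>, so that polynomials in them are power combinations.
\<close>

definition half_powers :: "nat ^ 'j::finite \<Rightarrow> real ^ 'j" where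
  "half_powers n = (\<chi> j. (1 / 2) ^ (n $ j))"

lemma polynomial_half_powers:
  fixes g :: "real ^ 'j::finite \<Rightarrow> real"
  assumes "real_polynomial_function g"
  shows "(\<lambda>n. g (half_powers n)) \<in> power_combinations"
  using assms
proof induction
  case (linear L)
  interpret bounded_linear L by fact
  have coordinate: "(\<lambda>n :: nat ^ 'j. (1 / 2) ^ (n $ k)) \<in> power_combinations" for k
  proof -
    have "(\<lambda>n :: nat ^ 'j. \<Prod>j\<in>UNIV. ((\<chi> j. if j = k then 1 / 2 else (1 :: real)) $ j) ^ (n $ j))
        \<in> power_combinations"
      by (intro power_combinations.power) simp
    moreover have "(\<Prod>j\<in>UNIV. ((\<chi> j. if j = k then 1 / 2 else (1 :: real)) $ j) ^ (n $ j)) = (1 / 2) ^ (n $ k)"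
      for n :: "nat ^ 'j"
    proof -
      have "(\<Prod>j\<in>UNIV. ((\<chi> j. if j = k then 1 / 2 else (1 :: real)) $ j) ^ (n $ j))
          = (\<Prod>j\<in>UNIV. if j = k then (1 / 2) ^ (n $ k) else 1)"
        by (intro prod.cong) auto
      then show ?thesis by simp
    qed
    ultimately show ?thesis by simp
  qed
  have expansion: "L x = (\<Sum>k\<in>UNIV. L (axis k 1) * (x $ k))" for x
  proof -
    have "L x = L (\<Sum>k\<in>UNIV. (x $ k) *\<^sub>R axis k 1)"
      using basis_expansion[of x] by (simp add: scalar_mult_eq_scaleR)
    then show ?thesis by (simp add: sum scaleR mult.commute)
  qed
  have "(\<lambda>n. L (half_powers n)) = (\<lambda>n. \<Sum>k\<in>UNIV. L (axis k 1) * (1 / 2) ^ (n $ k))"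
    by (subst expansion) (simp add: half_powers_def)
  also have "\<dots> \<in> power_combinations"
    by (intro power_combinations_sum power_combinations.scale coordinate) simp
  finally show ?case .
qed (auto intro: power_combinations_const power_combinations.add power_combinations_mult)

text \<open>
  Since the image of \<open>half_powers\<close> is discrete, the indicator of a point is the restriction of a
  continuous function on the cube (a product of tent functions), which the Stone--Weierstrass
  theorem approximates by polynomials.
\<close>

lemma power_combinations_dense:
  fixes m :: "nat ^ 'j::finite"
  assumes "0 < e"
  shows "\<exists>f\<in>power_combinations. \<forall>n. \<bar>indicator {m} n - f n\<bar> < e"
proof -
  define h :: "real ^ 'j \<Rightarrow> real" where
    "h y = (\<Prod>j\<in>UNIV. max 0 (1 - 2 ^ Suc (m $ j) * \<bar>y $ j - (1 / 2) ^ (m $ j)\<bar>))" for y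
  have "continuous_on {0..1} h"
    unfolding h_def by (intro continuous_intros)
  then obtain g where g: "real_polynomial_function g" "\<And>y. y \<in> {0..1} \<Longrightarrow> \<bar>h y - g y\<bar> < e"
    using Stone_Weierstrass_real_polynomial_function[of "{0..1}" h e] assms
    by (metis compact_cbox interval_cbox_cart)
  \<comment> \<open>Distinct powers of 1/2 are so far apart that the tent around one of them vanishes at
      the others.\<close>
  have gap: "1 \<le> 2 ^ Suc a * \<bar>(1 / 2) ^ b - (1 / 2) ^ a :: real\<bar>" if "a \<noteq> b" for a b :: nat
  proof (cases "a < b")
    case True
    then have "(1 / 2) ^ b \<le> (1 / 2 :: real) ^ Suc a" by (intro power_decreasing) auto
    moreover have "(1 / 2) ^ a = 2 * (1 / 2 :: real) ^ Suc a" by simp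
    ultimately have "(1 / 2) ^ Suc a \<le> \<bar>(1 / 2) ^ b - (1 / 2) ^ a :: real\<bar>" by linarith
    then have "2 ^ Suc a * (1 / 2) ^ Suc a \<le> 2 ^ Suc a * \<bar>(1 / 2) ^ b - (1 / 2) ^ a :: real\<bar>"
      by (intro mult_left_mono) auto
    then show ?thesis by (simp add: power_mult_distrib[symmetric] del: power_Suc)
  next
    case False
    then have "(1 / 2) ^ a \<le> (1 / 2 :: real) ^ Suc b" using that by (intro power_decreasing) auto
    moreover have "(1 / 2) ^ a \<le> (1 / 2 :: real) ^ b" using False by (intro power_decreasing) auto
    ultimately have "(1 / 2) ^ a \<le> \<bar>(1 / 2) ^ b - (1 / 2) ^ a :: real\<bar>" by simp
    then have "2 ^ Suc a * (1 / 2) ^ a \<le> 2 ^ Suc a * \<bar>(1 / 2) ^ b - (1 / 2) ^ a :: real\<bar>"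
      by (intro mult_left_mono) auto
    moreover have "2 ^ Suc a * (1 / 2 :: real) ^ a = 2" by (simp add: power_one_over)
    ultimately show ?thesis by linarith
  qed
  have h: "h (half_powers n) = indicator {m} n" for n
  proof (cases "n = m")
    case True
    then show ?thesis by (simp add: h_def half_powers_def)
  next
    case False
    then obtain j where "m $ j \<noteq> n $ j" by (metis vec_eq_iff)
    then have "max 0 (1 - 2 ^ Suc (m $ j) * \<bar>half_powers n $ j - (1 / 2) ^ (m $ j)\<bar>) = 0"
      using gap[of "m $ j" "n $ j"] by (simp add: half_powers_def del: power_Suc)
    then have "h (half_powers n) = 0"
      unfolding h_def by (intro prod_zero) (auto simp del: power_Suc)
    then show ?thesis using False by simp
  qed
  have "half_powers n \<in> {0..1}" for n :: "nat ^ 'j"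
    by (auto simp: half_powers_def less_eq_vec_def power_le_one)
  with g h show ?thesis
    by (intro bexI[of _ "\<lambda>n. g (half_powers n)"] polynomial_half_powers) (metis+)
qed

lemma integrable_bounded_pmf:
  fixes f :: "'a \<Rightarrow> real"
  assumes "\<And>x. \<bar>f x\<bar> \<le> C"
  shows "integrable (measure_pmf P) f"
  using assms by (intro measure_pmf.integrable_const_bound[where B = C]) auto

lemma expectation_power_combination_converges:
  fixes P :: "'i \<Rightarrow> (nat ^ 'j::finite) pmf"
  assumes "\<And>z. (\<And>j. 0 \<le> z $ j \<and> z $ j \<le> 1) \<Longrightarrow> \<exists>L. ((\<lambda>i. pgf (P i) z) \<longlongrightarrow> L) net"
    and "f \<in> power_combinations"
  shows "\<exists>L. ((\<lambda>i. measure_pmf.expectation (P i) f) \<longlongrightarrow> L) net"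
  using assms(2)
proof induction
  case (power z)
  then show ?case using assms(1)[of z] by (simp add: pgf_def)
next
  case (add f g)
  then obtain K L where "((\<lambda>i. measure_pmf.expectation (P i) f) \<longlongrightarrow> K) net"
    "((\<lambda>i. measure_pmf.expectation (P i) g) \<longlongrightarrow> L) net" by blast
  note add_lim = this
  show ?case
  proof (intro exI[of _ "K + L"])
    have "integrable (measure_pmf (P i)) f" "integrable (measure_pmf (P i)) g" for i
      using power_combinations_bounded[OF add.hyps(1)] power_combinations_bounded[OF add.hyps(2)]
      by (metis integrable_bounded_pmf)+
    then show "((\<lambda>i. measure_pmf.expectation (P i) (\<lambda>n. f n + g n)) \<longlongrightarrow> K + L) net"
      using tendsto_add[OF add_lim] by simp
  qed
next
  case (scale f c)
  then obtain L where "((\<lambda>i. measure_pmf.expectation (P i) f) \<longlongrightarrow> L) net" by blast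
  then have "((\<lambda>i. c * measure_pmf.expectation (P i) f) \<longlongrightarrow> c * L) net" by (rule tendsto_mult_left)
  then show ?case by (intro exI[of _ "c * L"]) simp
qed

lemma pmf_converges:
  fixes P :: "'i \<Rightarrow> (nat ^ 'j::finite) pmf"
  assumes "\<And>z. (\<And>j. 0 \<le> z $ j \<and> z $ j \<le> 1) \<Longrightarrow> \<exists>L. ((\<lambda>i. pgf (P i) z) \<longlongrightarrow> L) net"
  shows "\<exists>L. ((\<lambda>i. pmf (P i) m) \<longlongrightarrow> L) net"
proof -
  have "cauchy_filter (filtermap (\<lambda>i. pmf (P i) m) net)"
    unfolding cauchy_filter_metric_filtermap
  proof (intro allI impI)
    fix e :: real assume "0 < e"
    then obtain f where f: "f \<in> power_combinations" "\<And>n. \<bar>indicator {m} n - f n\<bar> < e / 4"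
      using power_combinations_dense[of "e / 4" m] by auto
    obtain L where L: "((\<lambda>i. measure_pmf.expectation (P i) f) \<longlongrightarrow> L) net"
      using expectation_power_combination_converges[OF assms f(1)] by blast
    obtain C where C: "\<And>n. \<bar>f n\<bar> \<le> C" using power_combinations_bounded[OF f(1)] by blast
    have close: "\<bar>pmf (P i) m - measure_pmf.expectation (P i) f\<bar> \<le> e / 4" for i
    proof -
      have "pmf (P i) m - measure_pmf.expectation (P i) f
          = measure_pmf.expectation (P i) (\<lambda>n. indicator {m} n - f n)"
        using integrable_bounded_pmf[OF C]
        by (subst Bochner_Integration.integral_diff)
          (auto simp: pmf.rep_eq integrable_bounded_pmf[where C = 1] indicator_def)
      also have "\<bar>\<dots>\<bar> \<le> measure_pmf.expectation (P i) (\<lambda>n. \<bar>indicator {m} n - f n\<bar>)"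
        by (rule integral_abs_bound)
      also have "\<dots> \<le> measure_pmf.expectation (P i) (\<lambda>n. e / 4)"
        using f(2) \<open>0 < e\<close>
          by (intro integral_mono integrable_bounded_pmf[where C = "e / 4"]) (auto intro: less_imp_le)
      finally show ?thesis by simp
    qed
    have "eventually (\<lambda>i. dist (measure_pmf.expectation (P i) f) L < e / 4) net"
      using L \<open>0 < e\<close> by (intro tendstoD) auto
    moreover have "dist (pmf (P i) m) (pmf (P k) m) < e"
      if "dist (measure_pmf.expectation (P i) f) L < e / 4"
        "dist (measure_pmf.expectation (P k) f) L < e / 4" for i k
      using close[of i] close[of k] that unfolding dist_real_def by linarith
    ultimately show "\<exists>Q. eventually Q net \<and> (\<forall>x y. Q x \<and> Q y \<longrightarrow> dist (pmf (P x) m) (pmf (P y) m) < e)"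
      by blast
  qed
  then have "convergent_filter (filtermap (\<lambda>i. pmf (P i) m) net)"
    by (rule cauchy_filter_convergent)
  then show ?thesis
    unfolding convergent_filter_iff filterlim_def by auto
qed

lemma finite_vec_sum_less: "finite {n :: nat ^ 'j::finite. (\<Sum>j\<in>UNIV. n $ j) < K}"
proof (rule finite_subset)
  show "finite ((\<lambda>f. \<chi> j. f j) ` (PiE (UNIV :: 'j set) (\<lambda>_. {..<K})))"
    by (intro finite_imageI finite_PiE) auto
  show "{n :: nat ^ 'j. (\<Sum>j\<in>UNIV. n $ j) < K} \<subseteq> (\<lambda>f. \<chi> j. f j) ` (PiE UNIV (\<lambda>_. {..<K}))"
  proof
    fix n :: "nat ^ 'j" assume "n \<in> {n. (\<Sum>j\<in>UNIV. n $ j) < K}"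
    moreover have "n $ k \<le> (\<Sum>j\<in>UNIV. n $ j)" for k by (rule member_le_sum) auto
    ultimately have "(\<lambda>k. n $ k) \<in> PiE UNIV (\<lambda>_. {..<K})" by (auto intro: le_less_trans)
    then show "n \<in> (\<lambda>f. \<chi> j. f j) ` (PiE UNIV (\<lambda>_. {..<K}))"
      by (intro image_eqI[of _ _ "\<lambda>k. n $ k"]) (auto simp: vec_eq_iff)
  qed
qed

text \<open>
  Markov's inequality for \<open>1 - u ^ \<Sum>j. n j\<close>. It turns a value of the generating function near 1
  into tightness.
\<close>

lemma prob_sum_ge:
  fixes P :: "(nat ^ 'j::finite) pmf"
  assumes "0 \<le> u" "u \<le> 1"
  shows "(1 - u ^ K) * measure_pmf.prob P {n. K \<le> (\<Sum>j\<in>UNIV. n $ j)} \<le> 1 - pgf P (\<chi> j. u)"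
proof -
  let ?A = "{n :: nat ^ 'j. K \<le> (\<Sum>j\<in>UNIV. n $ j)}"
  let ?u = "\<lambda>n :: nat ^ 'j. u ^ (\<Sum>j\<in>UNIV. n $ j)"
  have u: "0 \<le> u ^ m" "u ^ m \<le> 1" for m using assms by (simp_all add: power_le_one)
  have integrable: "integrable (measure_pmf P) ?u"
    using u by (intro integrable_bounded_pmf[where C = 1]) simp
  have pointwise: "(1 - u ^ K) * indicator ?A n \<le> 1 - ?u n" for n
  proof (cases "n \<in> ?A")
    case True
    then have "?u n \<le> u ^ K" using assms by (intro power_decreasing) simp_all
    then show ?thesis using True by simp
  next
    case False
    then show ?thesis using u(2)[of "\<Sum>j\<in>UNIV. n $ j"] by simp
  qed
  have "(1 - u ^ K) * measure_pmf.prob P ?A = measure_pmf.expectation P (\<lambda>n. (1 - u ^ K) * indicator ?A n)"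
    by simp
  also have "\<dots> \<le> measure_pmf.expectation P (\<lambda>n. 1 - ?u n)"
    using pointwise integrable
    by (intro integral_mono integrable_mult_right) (simp_all add: integrable_bounded_pmf[where C = 1])
  also have "\<dots> = 1 - pgf P (\<chi> j. u)"
    using integrable by (simp add: pgf_def power_sum)
  finally show ?thesis .
qed

text \<open>
  Pointwise convergence of the generating functions gives convergence of each point probability,
  by the approximation of indicators above. No mass escapes to infinity because the limit
  function comes arbitrarily near to 1 at points of the diagonal of the cube other than its end;
  hence the limits of the point probabilities form a probability distribution, and bounded
  functions may be cut off to a finite set up to a uniformly small error.
\<close>

theorem pgf_continuity:
  fixes P :: "'i \<Rightarrow> (nat ^ 'j::finite) pmf"
  assumes nontriv: "net \<noteq> bot"
    and lim: "\<And>z. (\<And>j. 0 \<le> z $ j \<and> z $ j \<le> 1) \<Longrightarrow> ((\<lambda>i. pgf (P i) z) \<longlongrightarrow> F z) net"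
    and at_1: "\<And>e. 0 < e \<Longrightarrow> \<exists>u. 0 \<le> u \<and> u < 1 \<and> 1 - e < F (\<chi> j. u)"
  shows "\<exists>p. \<forall>f :: nat ^ 'j \<Rightarrow> real. bounded (range f) \<longrightarrow>
    ((\<lambda>i. measure_pmf.expectation (P i) f) \<longlongrightarrow> measure_pmf.expectation p f) net"
proof -
  obtain r where r: "\<And>m. ((\<lambda>i. pmf (P i) m) \<longlongrightarrow> r m) net"
  proof -
    have "\<exists>L. ((\<lambda>i. pmf (P i) m) \<longlongrightarrow> L) net" for m
      by (rule pmf_converges) (use lim in blast)
    then have "\<exists>r. \<forall>m. ((\<lambda>i. pmf (P i) m) \<longlongrightarrow> r m) net" by (intro choice) blast
    then show ?thesis using that by blast
  qed
  have r_nonneg: "0 \<le> r m" for m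
    using tendsto_lowerbound[OF r _ nontriv] by auto
  have prob_lim: "((\<lambda>i. measure_pmf.prob (P i) A) \<longlongrightarrow> sum r A) net" if "finite A" for A
    using that by (auto simp: measure_measure_pmf_finite intro: tendsto_sum r)
  have tight: "\<exists>A. finite A \<and> eventually (\<lambda>i. 1 - e < measure_pmf.prob (P i) A) net" if "0 < e" for e :: real
  proof -
    obtain u where u: "0 \<le> u" "u < 1" "1 - e / 2 < F (\<chi> j. u)" using at_1[OF half_gt_zero[OF \<open>0 < e\<close>]] by blast
    obtain K where K: "u ^ K < 1 / 2" using real_arch_pow_inv[of "1 / 2" u] u by auto
    have "1 - e < measure_pmf.prob (P i) {n. (\<Sum>j\<in>UNIV. n $ j) < K}"
      if "1 - e / 2 < pgf (P i) (\<chi> j. u)" for i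
    proof -
      let ?B = "{n :: nat ^ 'j. K \<le> (\<Sum>j\<in>UNIV. n $ j)}"
      have "1 / 2 * measure_pmf.prob (P i) ?B \<le> (1 - u ^ K) * measure_pmf.prob (P i) ?B"
        using K by (intro mult_right_mono) auto
      also have "\<dots> \<le> 1 - pgf (P i) (\<chi> j. u)" using u by (intro prob_sum_ge) auto
      finally have "measure_pmf.prob (P i) ?B < e" using that by linarith
      moreover have "{n :: nat ^ 'j. (\<Sum>j\<in>UNIV. n $ j) < K} = UNIV - ?B" by auto
      ultimately show ?thesis using measure_pmf.prob_compl[of ?B "P i"] by simp
    qed
    moreover have "eventually (\<lambda>i. 1 - e / 2 < pgf (P i) (\<chi> j. u)) net"
      using u by (intro order_tendstoD(1)[OF lim]) auto
    ultimately have "eventually (\<lambda>i. 1 - e < measure_pmf.prob (P i) {n. (\<Sum>j\<in>UNIV. n $ j) < K}) net"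
      by (rule eventually_mono[rotated])
    then show ?thesis using finite_vec_sum_less[of K] by blast
  qed
  have sum_le: "sum r A \<le> 1" if "finite A" for A
    using tendsto_upperbound[OF prob_lim[OF that] _ nontriv] by auto
  have sum_ge: "1 - e \<le> sum r A" if "finite A" "eventually (\<lambda>i. 1 - e < measure_pmf.prob (P i) A) net" for A e
  proof -
    have "eventually (\<lambda>i. 1 - e \<le> measure_pmf.prob (P i) A) net"
      using that(2) by (rule eventually_mono) simp
    then show ?thesis using tendsto_lowerbound[OF prob_lim[OF that(1)] _ nontriv] by blast
  qed
  have total: "(\<integral>\<^sup>+n. ennreal (r n) \<partial>count_space UNIV) = 1"
  proof (rule antisym)
    have summable: "Infinite_Set_Sum.abs_summable_on r UNIV"
      using sum_le r_nonneg by (intro abs_summable_finite_sumsI[where B = 1]) auto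
    then have eq: "(\<integral>\<^sup>+n. ennreal (r n) \<partial>count_space UNIV) = ennreal (infsetsum r UNIV)"
      using r_nonneg by (intro nn_integral_conv_infsetsum) auto
    have "infsetsum r UNIV \<le> 1"
    proof -
      have "r summable_on UNIV" using summable by (metis abs_summable_equivalent abs_summable_summable)
      then have "infsum r UNIV \<le> 1" using sum_le by (intro infsum_le_finite_sums) auto
      then show ?thesis using infsetsum_infsum[OF summable] by simp
    qed
    then show "(\<integral>\<^sup>+n. ennreal (r n) \<partial>count_space UNIV) \<le> 1" by (simp add: eq)
    show "1 \<le> (\<integral>\<^sup>+n. ennreal (r n) \<partial>count_space UNIV)"
    proof (rule ennreal_le_epsilon)
      fix e :: real assume "0 < e"
      then obtain A where A: "finite A" "eventually (\<lambda>i. 1 - e < measure_pmf.prob (P i) A) net"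
        using tight by blast
      have "ennreal 1 \<le> ennreal (sum r A + e)" using sum_ge[OF A] by (intro ennreal_leI) auto
      also have "\<dots> = ennreal (sum r A) + ennreal e"
        using \<open>0 < e\<close> r_nonneg by (intro ennreal_plus) (auto intro: sum_nonneg)
      also have "ennreal (sum r A) = (\<integral>\<^sup>+n\<in>A. ennreal (r n) \<partial>count_space UNIV)"
        using A r_nonneg
        by (simp add: nn_integral_count_space_indicator[symmetric] nn_integral_count_space_finite sum_ennreal)
      also have "\<dots> \<le> (\<integral>\<^sup>+n. ennreal (r n) \<partial>count_space UNIV)"
        by (intro nn_integral_mono) (auto split: split_indicator)
      finally show "1 \<le> (\<integral>\<^sup>+n. ennreal (r n) \<partial>count_space UNIV) + ennreal e" by simp
    qed
  qed
  define p where "p = embed_pmf r"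
  have p: "pmf p m = r m" for m
    unfolding p_def using pmf_embed_pmf[of r] r_nonneg total by blast
  have "((\<lambda>i. measure_pmf.expectation (P i) f) \<longlongrightarrow> measure_pmf.expectation p f) net"
    if f: "bounded (range f)" for f :: "nat ^ 'j \<Rightarrow> real"
  proof (rule tendstoI)
    fix e :: real assume "0 < e"
    from f obtain C where C: "0 < C" "\<And>n. \<bar>f n\<bar> \<le> C" unfolding bounded_pos by auto
    define d where "d = e / (4 * C)"
    have "0 < d" using \<open>0 < e\<close> C by (simp add: d_def)
    then obtain A where A: "finite A" "eventually (\<lambda>i. 1 - d < measure_pmf.prob (P i) A) net"
      using tight by blast
    have split: "\<bar>measure_pmf.expectation Q f - (\<Sum>n\<in>A. pmf Q n * f n)\<bar> \<le> C * d"
      if "1 - d \<le> measure_pmf.prob Q A" for Q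
    proof -
      have "measure_pmf.expectation Q f
          = measure_pmf.expectation Q (\<lambda>n. indicator A n * f n + indicator (- A) n * f n)"
        by (intro Bochner_Integration.integral_cong) (auto split: split_indicator)
      also have "\<dots> = measure_pmf.expectation Q (\<lambda>n. indicator A n * f n)
          + measure_pmf.expectation Q (\<lambda>n. indicator (- A) n * f n)"
        using C by (intro Bochner_Integration.integral_add integrable_bounded_pmf[where C = C])
           (auto split: split_indicator)
      also have "measure_pmf.expectation Q (\<lambda>n. indicator A n * f n) = (\<Sum>n\<in>A. pmf Q n * f n)"
        using A by (subst integral_measure_pmf_real[where A = A])
          (auto simp: mult.commute intro!: sum.cong split: split_indicator_asm)
      finally have "measure_pmf.expectation Q f - (\<Sum>n\<in>A. pmf Q n * f n)
          = measure_pmf.expectation Q (\<lambda>n. indicator (- A) n * f n)" by simp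
      also have "\<bar>\<dots>\<bar> \<le> measure_pmf.expectation Q (\<lambda>n. \<bar>indicator (- A) n * f n\<bar>)"
        by (rule integral_abs_bound)
      also have "\<dots> \<le> measure_pmf.expectation Q (\<lambda>n. C * indicator (- A) n)"
        using C by (intro integral_mono integrable_bounded_pmf[where C = C])
          (auto split: split_indicator)
      also have "\<dots> = C * measure_pmf.prob Q (- A)" by simp
      also have "\<dots> \<le> C * d"
        using C that measure_pmf.prob_compl[of A Q]
        by (intro mult_left_mono) (auto simp: Compl_eq_Diff_UNIV)
      finally show ?thesis .
    qed
    have "1 - d \<le> measure_pmf.prob p A"
      using sum_ge[OF A] A(1) by (simp add: measure_measure_pmf_finite p)
    note p_split = split[OF this]
    have "((\<lambda>i. \<Sum>n\<in>A. pmf (P i) n * f n) \<longlongrightarrow> (\<Sum>n\<in>A. pmf p n * f n)) net"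
      unfolding p by (intro tendsto_intros r)
    then have "eventually (\<lambda>i. dist (\<Sum>n\<in>A. pmf (P i) n * f n) (\<Sum>n\<in>A. pmf p n * f n) < e / 4) net"
      using \<open>0 < e\<close> by (intro tendstoD) auto
    with A(2) show "eventually (\<lambda>i. dist (measure_pmf.expectation (P i) f) (measure_pmf.expectation p f) < e) net"
    proof eventually_elim
      case (elim i)
      have "C * d = e / 4" using C by (simp add: d_def)
      with elim p_split split[of "P i"] \<open>0 < e\<close> show ?case unfolding dist_real_def by linarith
    qed
  qed
  then show ?thesis by blast
qed

section \<open>Laws and measurability on countable spaces\<close>

lemma (in prob_space) law_pmf:
  fixes Y :: "'a \<Rightarrow> 'b::countable"
  assumes Y: "Y \<in> M \<rightarrow>\<^sub>M count_space UNIV"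
  shows "\<exists>p. \<forall>f :: 'b \<Rightarrow> real. measure_pmf.expectation p f = expectation (\<lambda>\<omega>. f (Y \<omega>))"
proof -
  interpret D: prob_space "distr M (count_space UNIV) Y" by (rule prob_space_distr[OF Y])
  have null: "emeasure (distr M (count_space UNIV) Y) {y. measure (distr M (count_space UNIV) Y) {y} = 0} = 0"
    by (subst emeasure_countable_singleton) (auto simp: D.emeasure_eq_measure nn_integral_0_iff_AE AE_count_space)
  have "AE y in distr M (count_space UNIV) Y. measure (distr M (count_space UNIV) Y) {y} \<noteq> 0"
    using null by (intro AE_I[OF _ null]) auto
  then have "measure_pmf (Abs_pmf (distr M (count_space UNIV) Y)) = distr M (count_space UNIV) Y"
    by (intro Abs_pmf_inverse) (simp add: D.prob_space_axioms)
  then have "measure_pmf.expectation (Abs_pmf (distr M (count_space UNIV) Y)) f = expectation (\<lambda>\<omega>. f (Y \<omega>))"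
    for f :: "'b \<Rightarrow> real"
    using Y by (simp add: integral_distr)
  then show ?thesis by blast
qed

lemma measurable_card_countable:
  fixes A :: "'a \<Rightarrow> 'b::countable set"
  assumes "\<And>p. {x \<in> space M. p \<in> A x} \<in> sets M"
  shows "(\<lambda>x. card (A x)) \<in> M \<rightarrow>\<^sub>M count_space UNIV"
proof -
  have "(\<lambda>x. card (to_nat ` A x)) \<in> M \<rightarrow>\<^sub>M count_space UNIV"
  proof (rule measurable_card)
    fix n
    have "{x \<in> space M. n \<in> to_nat ` A x}
        = (if to_nat (from_nat n :: 'b) = n then {x \<in> space M. from_nat n \<in> A x} else {})"
      by (auto simp: image_iff) (metis from_nat_to_nat)+
    then show "{x \<in> space M. n \<in> to_nat ` A x} \<in> sets M" using assms by simp
  qed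
  then show ?thesis by (simp add: card_image)
qed

lemma measurable_vec_countable:
  fixes f :: "'j::finite \<Rightarrow> 'a \<Rightarrow> 'b::countable"
  assumes [measurable]: "\<And>k. f k \<in> M \<rightarrow>\<^sub>M count_space UNIV"
  shows "(\<lambda>x. \<chi> k. f k x) \<in> M \<rightarrow>\<^sub>M count_space UNIV"
proof (subst measurable_count_space_eq2_countable, intro conjI ballI)
  fix n :: "'b ^ 'j"
  have "(\<lambda>x. \<chi> k. f k x) -` {n} \<inter> space M = {x \<in> space M. \<forall>k. f k x = n $ k}"
    by (auto simp: vec_eq_iff)
  then show "(\<lambda>x. \<chi> k. f k x) -` {n} \<inter> space M \<in> sets M" by simp
qed auto

text \<open>
  Every function on the state space is continuous, so that convergence in distribution includes
  convergence of point probabilities.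
\<close>

lemma open_discrete_vec: "open (A :: ('b::discrete_topology ^ 'j::finite) set)"
  unfolding open_vec_def
proof
  fix x assume "x \<in> A"
  then show "\<exists>C. (\<forall>i. open (C i) \<and> x $ i \<in> C i) \<and> (\<forall>y. (\<forall>i. y $ i \<in> C i) \<longrightarrow> y \<in> A)"
    by (intro exI[of _ "\<lambda>i. {x $ i}"]) (auto simp flip: vec_eq_iff intro: Topological_Spaces.open_discrete)
qed

section \<open>Independence of groups of sources\<close>

text \<open>
  Conditioning on one of two independent sigma-algebras. Independence says that the diagonal map
  \<open>\<omega> \<mapsto> (\<omega>, \<omega>)\<close> sends \<open>M\<close> to the product of its restrictions to \<open>A\<close> and \<open>R\<close>, so that Fubini's
  theorem applies to functions that are jointly measurable for these.
\<close>

lemma (in prob_space) expectation_diagonal: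
  fixes F :: "'a \<times> 'a \<Rightarrow> real"
  assumes indep: "indep_var A (\<lambda>\<omega>. \<omega>) R (\<lambda>\<omega>. \<omega>)"
    and F[measurable]: "F \<in> borel_measurable (A \<Otimes>\<^sub>M R)"
    and bounded: "\<And>x. \<bar>F x\<bar> \<le> C"
  shows "expectation (\<lambda>\<omega>. F (\<omega>, \<omega>)) = expectation (\<lambda>\<omega>. expectation (\<lambda>\<omega>'. F (\<omega>, \<omega>')))"
proof -
  have A[measurable]: "(\<lambda>\<omega>. \<omega>) \<in> M \<rightarrow>\<^sub>M A" and R[measurable]: "(\<lambda>\<omega>. \<omega>) \<in> M \<rightarrow>\<^sub>M R"
    using indep by (auto dest: indep_var_rv1 indep_var_rv2)
  have joint: "distr M A (\<lambda>\<omega>. \<omega>) \<Otimes>\<^sub>M distr M R (\<lambda>\<omega>. \<omega>) = distr M (A \<Otimes>\<^sub>M R) (\<lambda>\<omega>. (\<omega>, \<omega>))"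
    using indep by (simp add: indep_var_distribution_eq)
  interpret A: prob_space "distr M A (\<lambda>\<omega>. \<omega>)" by (rule prob_space_distr) fact
  interpret R: prob_space "distr M R (\<lambda>\<omega>. \<omega>)" by (rule prob_space_distr) fact
  interpret AR: pair_prob_space "distr M A (\<lambda>\<omega>. \<omega>)" "distr M R (\<lambda>\<omega>. \<omega>)" ..
  have F': "F \<in> borel_measurable (distr M A (\<lambda>\<omega>. \<omega>) \<Otimes>\<^sub>M distr M R (\<lambda>\<omega>. \<omega>))"
    by simp
  have "expectation (\<lambda>\<omega>. F (\<omega>, \<omega>)) = integral\<^sup>L (distr M (A \<Otimes>\<^sub>M R) (\<lambda>\<omega>. (\<omega>, \<omega>))) F"
    by (subst integral_distr) auto
  also have "\<dots> = (\<integral>x. \<integral>y. F (x, y) \<partial>distr M R (\<lambda>\<omega>. \<omega>) \<partial>distr M A (\<lambda>\<omega>. \<omega>))"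
    unfolding joint[symmetric]
    using bounded F' by (intro AR.integral_fst'[symmetric] AR.P.integrable_const_bound[where B = C]) auto
  also have "\<dots> = expectation (\<lambda>\<omega>. \<integral>y. F (\<omega>, y) \<partial>distr M R (\<lambda>\<omega>. \<omega>))"
    using R.borel_measurable_lebesgue_integral[of "\<lambda>x y. F (x, y)" A] by (intro integral_distr) simp_all
  also have "\<dots> = expectation (\<lambda>\<omega>. expectation (\<lambda>\<omega>'. F (\<omega>, \<omega>')))"
  proof (rule Bochner_Integration.integral_cong[OF refl])
    fix \<omega> assume "\<omega> \<in> space M"
    then have "\<omega> \<in> space A" using measurable_space[OF A] by simp
    then show "(\<integral>y. F (\<omega>, y) \<partial>distr M R (\<lambda>\<omega>. \<omega>)) = expectation (\<lambda>\<omega>'. F (\<omega>, \<omega>'))"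
      by (intro integral_distr) measurable
  qed
  finally show ?thesis .
qed

context batch_network
begin

definition joint_algebra :: "'j source set \<Rightarrow> 'a measure" where
  "joint_algebra K = sigma (space M) (\<Union>r\<in>K. sets (source_algebra M T B X r))"

lemma space_source: "space (source_algebra M T B X r) = space M"
  by (cases r) (simp_all add: process_algebra_def)

lemma sets_source_subset: "sets (source_algebra M T B X r) \<subseteq> events"
  using independence by (auto simp: indep_sets_def)

lemma sources_into_space: "(\<Union>r\<in>K. sets (source_algebra M T B X r)) \<subseteq> Pow (space M)"
proof (intro UN_least subsetI PowI)
  fix r A \<omega> assume "A \<in> sets (source_algebra M T B X r)" "\<omega> \<in> A"
  then show "\<omega> \<in> space M" using sets.sets_into_space space_source by blast
qed

lemma space_joint[simp]: "space (joint_algebra K) = space M"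
  unfolding joint_algebra_def by (rule space_measure_of[OF sources_into_space])

lemma sets_joint: "sets (joint_algebra K) = sigma_sets (space M) (\<Union>r\<in>K. sets (source_algebra M T B X r))"
  unfolding joint_algebra_def by (rule sets_measure_of[OF sources_into_space])

lemma measurable_joint: "(\<lambda>\<omega>. \<omega>) \<in> M \<rightarrow>\<^sub>M joint_algebra K"
proof (rule measurableI)
  fix A assume "A \<in> sets (joint_algebra K)"
  then have "A \<in> events"
    unfolding sets_joint using sets_source_subset by (induction rule: sigma_sets.induct) auto
  then show "(\<lambda>\<omega>. \<omega>) -` A \<inter> space M \<in> events" by simp
qed simp

lemma measurable_joint_source:
  assumes "r \<in> K"
  shows "(\<lambda>\<omega>. \<omega>) \<in> joint_algebra K \<rightarrow>\<^sub>M source_algebra M T B X r"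
proof (rule measurableI)
  fix A assume A: "A \<in> sets (source_algebra M T B X r)"
  then have "A \<subseteq> space M" using sets.sets_into_space space_source by metis
  moreover have "A \<in> sets (joint_algebra K)"
    unfolding sets_joint using A assms by (intro sigma_sets.Basic) auto
  ultimately show "(\<lambda>\<omega>. \<omega>) -` A \<inter> space (joint_algebra K) \<in> sets (joint_algebra K)"
    by (simp add: Int_absorb2)
qed (simp add: space_source)

lemma arrival_measurable:
  assumes "Arrivals \<in> K"
  shows "T i \<in> joint_algebra K \<rightarrow>\<^sub>M borel"
proof -
  have "(\<lambda>\<omega> i. T i \<omega>) \<in> source_algebra M T B X Arrivals \<rightarrow>\<^sub>M Pi\<^sub>M UNIV (\<lambda>_. borel)"
    by (simp add: measurable_vimage_algebra1 space_PiM)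
  then have "(\<lambda>\<omega>. (\<lambda>i. T i \<omega>) i) \<in> source_algebra M T B X Arrivals \<rightarrow>\<^sub>M borel"
    by (rule measurable_compose[OF _ measurable_component_singleton]) simp
  from measurable_compose[OF measurable_joint_source[OF assms] this] show ?thesis by simp
qed

lemma batch_measurable:
  assumes "Batch i \<in> K"
  shows "B i \<in> joint_algebra K \<rightarrow>\<^sub>M count_space UNIV"
proof -
  have "B i \<in> source_algebra M T B X (Batch i) \<rightarrow>\<^sub>M count_space UNIV"
    by (simp add: measurable_vimage_algebra1)
  from measurable_compose[OF measurable_joint_source[OF assms] this] show ?thesis by simp
qed

text \<open>
  The position of a customer at a time that depends on other sources. That \<open>f\<close> and \<open>s\<close> may
  depend on \<open>x\<close> in unrelated ways is what later allows the time to be taken from one copy of the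
  probability space and the customer process from another.
\<close>

lemma position_measurable:
  assumes K: "Customer i j l \<in> K"
    and f: "f \<in> N \<rightarrow>\<^sub>M joint_algebra K" and s: "s \<in> borel_measurable N" "\<And>x. 0 \<le> s x"
  shows "(\<lambda>x. X i j l (f x) (s x)) \<in> N \<rightarrow>\<^sub>M count_space UNIV"
proof -
  have "f \<in> N \<rightarrow>\<^sub>M process_algebra M (X i j l)"
    using measurable_compose[OF f measurable_joint_source[OF K]] by simp
  moreover have "s \<in> N \<rightarrow>\<^sub>M restrict_space borel {0..}"
    using s by (intro measurable_restrict_space2) auto
  ultimately have "(\<lambda>x. (f x, s x)) \<in> N \<rightarrow>\<^sub>M process_algebra M (X i j l) \<Otimes>\<^sub>M restrict_space borel {0..}"
    by (rule measurable_Pair)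
  from measurable_compose[OF this process_measurable] show ?thesis by simp
qed

text \<open>
  The sigma-algebra of each source is closed under intersection, which is what independence
  needs in order to pass from the sources to the sigma-algebras generated by groups of them.
\<close>

lemma joint_independent:
  assumes "disjoint_family_on K I"
  shows "indep_vars (\<lambda>m. joint_algebra (K m)) (\<lambda>m \<omega>. \<omega>) I"
proof -
  have "indep_sets (\<lambda>m. sigma_sets (space M) (\<Union>r\<in>K m. sets (source_algebra M T B X r))) I"
  proof (rule indep_sets_collect_sigma)
    show "indep_sets (\<lambda>r. sets (source_algebra M T B X r)) (\<Union>m\<in>I. K m)"
      using independence by (rule indep_sets_mono_index[rotated]) simp
  qed (use assms in \<open>auto intro: sets.Int_stable\<close>)
  moreover have "{(\<lambda>\<omega>. \<omega>) -` A \<inter> space M |A. A \<in> sets (joint_algebra (K m))} = sets (joint_algebra (K m))" for m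
    using sets.sets_into_space[of _ "joint_algebra (K m)"]
    by (auto simp: Int_absorb2 intro!: exI)
  ultimately show ?thesis
    unfolding indep_vars_def2 by (simp add: measurable_joint sets_joint)
qed

lemma joint_independent_pair:
  assumes "K \<inter> L = {}"
  shows "indep_var (joint_algebra K) (\<lambda>\<omega>. \<omega>) (joint_algebra L) (\<lambda>\<omega>. \<omega>)"
proof -
  have "disjoint_family_on (case_bool K L) UNIV"
    using assms by (auto simp: disjoint_family_on_def split: bool.splits)
  from joint_independent[OF this] show ?thesis
    unfolding indep_var_def
    by (rule iffD1[OF indep_vars_cong, rotated -1]) (auto split: bool.splits)
qed

section \<open>The generating function of one batch\<close>

text \<open>
  Products of these weights over customers are \<open>\<Prod>k. z k ^ (number of customers in queue k)\<close>;
  customers that have left contribute the factor 1.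
\<close>

definition weight :: "real ^ 'j \<Rightarrow> 'j option \<Rightarrow> real" where
  "weight z x = (case x of None \<Rightarrow> 1 | Some k \<Rightarrow> z $ k)"

definition batch_weight :: "real ^ 'j \<Rightarrow> nat \<Rightarrow> real \<Rightarrow> 'a \<Rightarrow> real" where
  "batch_weight z i \<tau> \<omega> = (\<Prod>j\<in>UNIV. \<Prod>l<B i \<omega> $ j. weight z (X i j l \<omega> \<tau>))"

text \<open>
  The generating functions of the positions of one customer, by queue of entry, a time \<open>\<tau>\<close> after
  arrival; the mass that is missing from the \<open>q j k \<tau>\<close> belongs to customers that have left.
\<close>

definition customer_pgf :: "real ^ 'j \<Rightarrow> real \<Rightarrow> real ^ 'j" where
  "customer_pgf z \<tau> = (\<chi> j. 1 - (\<Sum>k\<in>UNIV. (1 - z $ k) * q j k \<tau>))"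

definition batch_pgf :: "real ^ 'j \<Rightarrow> real \<Rightarrow> real" where
  "batch_pgf z \<tau> = pgf S (customer_pgf z \<tau>)"

definition unit_cube :: "(real ^ 'j) set" where
  "unit_cube = {z. \<forall>j. 0 \<le> z $ j \<and> z $ j \<le> 1}"

lemma weight_range: "z \<in> unit_cube \<Longrightarrow> 0 \<le> weight z x" "z \<in> unit_cube \<Longrightarrow> weight z x \<le> 1"
  by (auto simp: weight_def unit_cube_def split: option.splits)

lemma batch_weight_range:
  assumes "z \<in> unit_cube"
  shows "0 \<le> batch_weight z i \<tau> \<omega>" "batch_weight z i \<tau> \<omega> \<le> 1"
  using weight_range[OF assms] unfolding batch_weight_def by (auto intro!: prod_nonneg prod_le_1)

lemma weights_product_measurable:
  assumes [measurable]: "b \<in> N \<rightarrow>\<^sub>M count_space UNIV"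
    and w: "\<And>j l. w j l \<in> borel_measurable N"
  shows "(\<lambda>x. \<Prod>j\<in>(UNIV :: 'j set). \<Prod>l<(b x :: nat ^ 'j) $ j. w j l x :: real) \<in> borel_measurable N"
proof (rule measurable_compose_countable[where g = b])
  show "(\<lambda>x. \<Prod>j\<in>UNIV. \<Prod>l<(c :: nat ^ 'j) $ j. w j l x) \<in> borel_measurable N" for c
    by (intro borel_measurable_prod w)
qed fact

lemma weight_measurable: "weight z \<in> count_space UNIV \<rightarrow>\<^sub>M borel"
  by simp

lemma batch_weight_measurable:
  assumes "Batch i \<in> K" "\<And>j l. Customer i j l \<in> K"
    and f: "f \<in> N \<rightarrow>\<^sub>M joint_algebra K" and s: "s \<in> borel_measurable N" "\<And>x. 0 \<le> s x"
  shows "(\<lambda>x. batch_weight z i (s x) (f x)) \<in> borel_measurable N"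
  unfolding batch_weight_def
  by (intro weights_product_measurable measurable_compose[OF position_measurable[where K = K] weight_measurable]
      measurable_compose[OF f batch_measurable] assms)

lemma position_event: "0 \<le> \<tau> \<Longrightarrow> {\<omega> \<in> space M. X i j l \<omega> \<tau> = x} \<in> events"
  using position_measurable[of i j l UNIV "\<lambda>\<omega>. \<omega>" M "\<lambda>_. \<tau>"]
  by (auto simp: measurable_joint intro!: measurable_sets_Collect)

lemma expectation_weight:
  assumes "0 \<le> \<tau>"
  shows "expectation (\<lambda>\<omega>. weight z (X i j l \<omega> \<tau>)) = customer_pgf z \<tau> $ j"
proof -
  define E where "E k = {\<omega> \<in> space M. X i j l \<omega> \<tau> = Some k}" for k
  have E: "E k \<in> events" "E k \<inter> space M = E k" for k
    using position_event[OF assms] by (auto simp: E_def)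
  have "expectation (\<lambda>\<omega>. weight z (X i j l \<omega> \<tau>))
      = expectation (\<lambda>\<omega>. 1 - (\<Sum>k\<in>UNIV. (1 - z $ k) * indicator (E k) \<omega>))"
  proof (intro Bochner_Integration.integral_cong refl)
    fix \<omega> assume \<omega>: "\<omega> \<in> space M"
    show "weight z (X i j l \<omega> \<tau>) = 1 - (\<Sum>k\<in>UNIV. (1 - z $ k) * indicator (E k) \<omega>)"
    proof (cases "X i j l \<omega> \<tau>")
      case (Some m)
      then have "(\<Sum>k\<in>UNIV. (1 - z $ k) * indicator (E k) \<omega>) = (\<Sum>k\<in>UNIV. if k = m then 1 - z $ m else 0)"
        using \<omega> by (intro sum.cong) (auto simp: E_def)
      then show ?thesis using Some by (simp add: weight_def)
    qed (simp add: weight_def E_def)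
  qed
  also have "\<dots> = 1 - (\<Sum>k\<in>UNIV. (1 - z $ k) * prob (E k))"
  proof -
    have int: "integrable M (\<lambda>\<omega>. (1 - z $ k) * indicator (E k) \<omega>)" for k
      by (intro E integrable_mult_right integrable_real_indicator) (auto simp: less_top[symmetric])
    have "expectation (\<lambda>\<omega>. 1 - (\<Sum>k\<in>UNIV. (1 - z $ k) * indicator (E k) \<omega>))
        = expectation (\<lambda>_. 1) - expectation (\<lambda>\<omega>. \<Sum>k\<in>UNIV. (1 - z $ k) * indicator (E k) \<omega>)"
      by (intro Bochner_Integration.integral_diff Bochner_Integration.integrable_sum int) simp
    also have "expectation (\<lambda>\<omega>. \<Sum>k\<in>UNIV. (1 - z $ k) * indicator (E k) \<omega>)
        = (\<Sum>k\<in>UNIV. expectation (\<lambda>\<omega>. (1 - z $ k) * indicator (E k) \<omega>))"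
      by (intro Bochner_Integration.integral_sum int)
    finally show ?thesis using E by (simp add: prob_space)
  qed
  finally show ?thesis
    using assms by (simp add: customer_pgf_def position_prob E_def)
qed

lemma expectation_batch_size: "expectation (\<lambda>\<omega>. f (B i \<omega>)) = measure_pmf.expectation S f"
  for f :: "nat ^ 'j \<Rightarrow> real"
proof -
  have "B i \<in> M \<rightarrow>\<^sub>M count_space UNIV"
    using measurable_compose[OF measurable_joint batch_measurable[of i UNIV]] by simp
  then have "expectation (\<lambda>\<omega>. f (B i \<omega>)) = integral\<^sup>L (distr M (count_space UNIV) (B i)) f"
    by (subst integral_distr) auto
  then show ?thesis by (simp add: batch_distr)
qed

text \<open>
  Given the sizes of the batch, its customers are independent, so each contributes a factor
  \<open>customer_pgf z \<tau> $ j\<close>; averaging over the sizes composes this with the generating function of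
  \<open>S\<close>.
\<close>

lemma expectation_batch_weight:
  assumes z: "z \<in> unit_cube" and \<tau>: "0 \<le> \<tau>"
  shows "expectation (batch_weight z i \<tau>) = batch_pgf z \<tau>"
proof -
  let ?C = "{Customer i j l |j l. True}"
  let ?F = "\<lambda>(\<omega>, \<omega>'). \<Prod>j\<in>UNIV. \<Prod>l<B i \<omega> $ j. weight z (X i j l \<omega>' \<tau>)"
  have indep: "indep_var (joint_algebra {Batch i}) (\<lambda>\<omega>. \<omega>) (joint_algebra ?C) (\<lambda>\<omega>. \<omega>)"
    by (rule joint_independent_pair) auto
  have F: "?F \<in> borel_measurable (joint_algebra {Batch i} \<Otimes>\<^sub>M joint_algebra ?C)"
    unfolding split_beta
    by (intro weights_product_measurable measurable_compose[OF position_measurable[where K = ?C] weight_measurable]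
        measurable_compose[OF measurable_fst batch_measurable]) (auto simp: \<tau>)
  have "expectation (batch_weight z i \<tau>) = expectation (\<lambda>\<omega>. ?F (\<omega>, \<omega>))"
    by (simp add: batch_weight_def[abs_def])
  also have "\<dots> = expectation (\<lambda>\<omega>. expectation (\<lambda>\<omega>'. ?F (\<omega>, \<omega>')))"
    using weight_range[OF z] by (intro expectation_diagonal[OF indep F, where C = 1])
      (auto simp: abs_prod intro!: prod_le_1 prod_nonneg)
  also have "\<dots> = expectation (\<lambda>\<omega>. \<Prod>j\<in>UNIV. (customer_pgf z \<tau> $ j) ^ (B i \<omega> $ j))"
  proof (intro Bochner_Integration.integral_cong refl)
    fix \<omega>
    let ?I = "SIGMA j:UNIV. {..<B i \<omega> $ j}"
    let ?w = "\<lambda>(j, l) \<omega>'. weight z (X i j l \<omega>' \<tau>)"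
    have "disjoint_family_on (\<lambda>(j, l). {Customer i j l :: 'j source}) ?I"
      by (auto simp: disjoint_family_on_def)
    from joint_independent[OF this] have "indep_vars (\<lambda>_. borel) ?w ?I"
      by (rule indep_vars_compose2)
         (auto intro!: measurable_compose[OF position_measurable weight_measurable] \<tau>)
    then have "expectation (\<lambda>\<omega>'. \<Prod>p\<in>?I. ?w p \<omega>') = (\<Prod>p\<in>?I. expectation (?w p))"
    proof (intro indep_vars_lebesgue_integral)
      show "integrable M (?w p)" for p
        using weight_range[OF z] \<tau>
        by (cases p) (auto intro!: integrable_const_bound[where B = 1] measurable_joint
            measurable_compose[OF position_measurable[where K = UNIV] weight_measurable])
    qed auto
    moreover have "(\<Prod>p\<in>?I. g p) = (\<Prod>j\<in>UNIV. \<Prod>l<B i \<omega> $ j. g (j, l))" for g :: "'j \<times> nat \<Rightarrow> real"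
      by (simp add: prod.Sigma)
    ultimately show "expectation (\<lambda>\<omega>'. ?F (\<omega>, \<omega>')) = (\<Prod>j\<in>UNIV. (customer_pgf z \<tau> $ j) ^ (B i \<omega> $ j))"
      by (simp add: expectation_weight[OF \<tau>])
  qed
  also have "\<dots> = batch_pgf z \<tau>"
    unfolding batch_pgf_def pgf_def
    by (rule expectation_batch_size[of "\<lambda>b. \<Prod>j\<in>UNIV. (customer_pgf z \<tau> $ j) ^ (b $ j)"])
  finally show ?thesis .
qed

lemma batch_weight_integrable:
  assumes "z \<in> unit_cube" "0 \<le> \<tau>"
  shows "integrable M (batch_weight z i \<tau>)"
  using batch_weight_range[OF assms(1)] assms(2) measurable_joint
  by (intro integrable_const_bound[where B = 1] batch_weight_measurable[where K = UNIV]) auto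

lemma batch_pgf_range:
  assumes "z \<in> unit_cube" "0 \<le> \<tau>"
  shows "0 \<le> batch_pgf z \<tau>" "batch_pgf z \<tau> \<le> 1"
proof -
  have "integrable M (batch_weight z 0 \<tau>)" using assms by (rule batch_weight_integrable)
  then show "0 \<le> batch_pgf z \<tau>" "batch_pgf z \<tau> \<le> 1"
    unfolding expectation_batch_weight[OF assms, of 0, symmetric]
    using batch_weight_range[OF assms(1)]
    by (auto intro!: integral_nonneg integral_le_const)
qed

lemma batch_pgf_measurable:
  assumes [measurable]: "s \<in> borel_measurable N" and nonneg: "\<And>x. 0 \<le> s x" and z: "z \<in> unit_cube"
  shows "(\<lambda>x. batch_pgf z (s x)) \<in> borel_measurable N"
proof -
  have [measurable]: "s \<in> N \<rightarrow>\<^sub>M restrict_space borel {0..}"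
    using nonneg by (intro measurable_restrict_space2) auto
  note q_measurable[measurable]
  have [measurable]: "(\<lambda>x. customer_pgf z (s x) $ j) \<in> borel_measurable N" for j
    unfolding customer_pgf_def vec_lambda_beta by measurable
  have "(\<lambda>(x, b). \<Prod>j\<in>UNIV. (customer_pgf z (s x) $ j) ^ (b $ j))
      \<in> borel_measurable (N \<Otimes>\<^sub>M measure_pmf S)"
    unfolding split_beta
  proof (rule measurable_compose_countable[where g = snd])
    show "(\<lambda>x. \<Prod>j\<in>UNIV. (customer_pgf z (s (fst x)) $ j) ^ ((b :: nat ^ 'j) $ j))
      \<in> borel_measurable (N \<Otimes>\<^sub>M measure_pmf S)" for b
      by measurable
    show "snd \<in> N \<Otimes>\<^sub>M measure_pmf S \<rightarrow>\<^sub>M count_space UNIV"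
      using measurable_snd[of N "measure_pmf S"] by simp
  qed
  from measure_pmf.borel_measurable_lebesgue_integral[OF this] show ?thesis
    unfolding batch_pgf_def pgf_def .
qed

section \<open>The generating function of the queue lengths\<close>

lemma random_variables[measurable]:
  "T i \<in> M \<rightarrow>\<^sub>M borel" "B i \<in> M \<rightarrow>\<^sub>M count_space UNIV"
  using measurable_compose[OF measurable_joint arrival_measurable[of UNIV i]]
    measurable_compose[OF measurable_joint batch_measurable[of i UNIV]] by simp_all

text \<open>
  Given the arrival times, the batches are independent, and a batch that arrived at time \<open>s\<close>
  contributes its generating function at age \<open>t - s\<close>. The age is written \<open>max 0 (t - s)\<close>, which
  agrees with \<open>t - s\<close> where it matters, because the customer processes are measurable functions
  of nonnegative times.
\<close>

lemma expectation_all_batches: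
  assumes z: "z \<in> unit_cube"
  shows "expectation (\<lambda>\<omega>. \<Prod>i<n. if T i \<omega> \<le> t then batch_weight z i (max 0 (t - T i \<omega>)) \<omega> else 1)
    = expectation (\<lambda>\<omega>. \<Prod>i<n. if T i \<omega> \<le> t then batch_pgf z (max 0 (t - T i \<omega>)) else 1)"
proof -
  let ?A = "joint_algebra {Arrivals}" and ?R = "joint_algebra (- {Arrivals})"
  let ?F = "\<lambda>(\<omega>, \<omega>'). \<Prod>i<n. if T i \<omega> \<le> t then batch_weight z i (max 0 (t - T i \<omega>)) \<omega>' else 1"
  have indep: "indep_var ?A (\<lambda>\<omega>. \<omega>) ?R (\<lambda>\<omega>. \<omega>)"
    by (rule joint_independent_pair) simp
  have F: "?F \<in> borel_measurable (?A \<Otimes>\<^sub>M ?R)"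
  proof -
    have [measurable]: "(\<lambda>x. T i (fst x)) \<in> borel_measurable (?A \<Otimes>\<^sub>M ?R)" for i
      by (rule measurable_compose[OF measurable_fst arrival_measurable]) simp
    have [measurable]: "(\<lambda>x. batch_weight z i (max 0 (t - T i (fst x))) (snd x)) \<in> borel_measurable (?A \<Otimes>\<^sub>M ?R)" for i
      by (rule batch_weight_measurable[where K = "- {Arrivals}"]) auto
    show ?thesis unfolding split_beta by measurable
  qed
  have "expectation (\<lambda>\<omega>. ?F (\<omega>, \<omega>)) = expectation (\<lambda>\<omega>. expectation (\<lambda>\<omega>'. ?F (\<omega>, \<omega>')))"
    using batch_weight_range[OF z] by (intro expectation_diagonal[OF indep F, where C = 1])
      (auto simp: abs_prod intro!: prod_le_1)
  also have "\<dots> = expectation (\<lambda>\<omega>. \<Prod>i<n. if T i \<omega> \<le> t then batch_pgf z (max 0 (t - T i \<omega>)) else 1)"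
  proof (rule Bochner_Integration.integral_cong[OF refl])
    fix \<omega>
    let ?K = "\<lambda>i. insert (Batch i) {Customer i j l |j l. True} :: 'j source set"
    let ?w = "\<lambda>i \<omega>'. if T i \<omega> \<le> t then batch_weight z i (max 0 (t - T i \<omega>)) \<omega>' else 1"
    have w_measurable: "?w i \<in> borel_measurable (joint_algebra (?K i))" for i
    proof -
      have "batch_weight z i (max 0 (t - T i \<omega>)) \<in> borel_measurable (joint_algebra (?K i))"
        by (rule batch_weight_measurable[where K = "?K i"]) auto
      then show ?thesis by simp
    qed
    have "disjoint_family_on ?K {..<n}"
      by (auto simp: disjoint_family_on_def)
    from joint_independent[OF this] have "indep_vars (\<lambda>_. borel) ?w {..<n}"
      by (rule indep_vars_compose2) (rule w_measurable)
    moreover have "integrable M (?w i)" for i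
      using batch_weight_range[OF z] measurable_compose[OF measurable_joint w_measurable]
      by (intro integrable_const_bound[where B = 1]) auto
    ultimately have "expectation (\<lambda>\<omega>'. \<Prod>i<n. ?w i \<omega>') = (\<Prod>i<n. expectation (?w i))"
      by (intro indep_vars_lebesgue_integral) auto
    also have "\<dots> = (\<Prod>i<n. if T i \<omega> \<le> t then batch_pgf z (max 0 (t - T i \<omega>)) else 1)"
      by (intro prod.cong refl) (auto simp: expectation_batch_weight[OF z] prob_space)
    finally show "expectation (\<lambda>\<omega>'. ?F (\<omega>, \<omega>'))
        = (\<Prod>i<n. if T i \<omega> \<le> t then batch_pgf z (max 0 (t - T i \<omega>)) else 1)" by simp
  qed
  finally show ?thesis by simp
qed

lemma queue_lengths_measurable[measurable]: "queue_lengths T B X t \<in> M \<rightarrow>\<^sub>M count_space UNIV"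
proof -
  have "{\<omega> \<in> space M. (i, j, l) \<in> {(i, j, l). T i \<omega> \<le> t \<and> l < B i \<omega> $ j \<and> X i j l \<omega> (t - T i \<omega>) = Some k}} \<in> events"
    for i j l k
  proof -
    have [measurable]: "(\<lambda>\<omega>. X i j l \<omega> (max 0 (t - T i \<omega>))) \<in> M \<rightarrow>\<^sub>M count_space UNIV"
      by (rule position_measurable[where K = UNIV]) (auto simp: measurable_joint)
    have "{\<omega> \<in> space M. T i \<omega> \<le> t \<and> l < B i \<omega> $ j \<and> X i j l \<omega> (max 0 (t - T i \<omega>)) = Some k} \<in> events"
      by measurable
    moreover have "{\<omega> \<in> space M. (i, j, l) \<in> {(i, j, l). T i \<omega> \<le> t \<and> l < B i \<omega> $ j \<and> X i j l \<omega> (t - T i \<omega>) = Some k}}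
        = {\<omega> \<in> space M. T i \<omega> \<le> t \<and> l < B i \<omega> $ j \<and> X i j l \<omega> (max 0 (t - T i \<omega>)) = Some k}"
      by (auto simp: max_def)
    ultimately show ?thesis by simp
  qed
  then have "{\<omega> \<in> space M. p \<in> {(i, j, l). T i \<omega> \<le> t \<and> l < B i \<omega> $ j \<and> X i j l \<omega> (t - T i \<omega>) = Some k}} \<in> events"
    for p k by (cases p) blast
  then have "(\<lambda>\<omega>. card {(i, j, l). T i \<omega> \<le> t \<and> l < B i \<omega> $ j \<and> X i j l \<omega> (t - T i \<omega>) = Some k})
      \<in> M \<rightarrow>\<^sub>M count_space UNIV" for k
    by (rule measurable_card_countable)
  then show ?thesis
    unfolding queue_lengths_def[abs_def] by (rule measurable_vec_countable)
qed

lemma weight_eq_prod: "weight z x = (\<Prod>k\<in>UNIV. if x = Some k then z $ k else 1)"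
proof (cases x)
  case (Some m)
  then have "(\<Prod>k\<in>UNIV. if x = Some k then z $ k else 1) = (\<Prod>k\<in>UNIV. if m = k then z $ m else 1)"
    by (intro prod.cong) auto
  then show ?thesis using Some by (simp add: weight_def)
qed (simp add: weight_def)

lemma prod_queue_lengths:
  assumes fin: "finite {i. T i \<omega> \<le> t}"
  shows "(\<Prod>k\<in>UNIV. (z $ k) ^ (queue_lengths T B X t \<omega> $ k))
    = (\<Prod>i | T i \<omega> \<le> t. batch_weight z i (max 0 (t - T i \<omega>)) \<omega>)"
proof -
  let ?I = "{i. T i \<omega> \<le> t}"
  let ?C = "SIGMA i:?I. SIGMA j:(UNIV :: 'j set). {..<B i \<omega> $ j}"
  let ?x = "\<lambda>(i, j, l). X i j l \<omega> (t - T i \<omega>)"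
  have "{(i, j, l). T i \<omega> \<le> t \<and> l < B i \<omega> $ j \<and> X i j l \<omega> (t - T i \<omega>) = Some k}
      = {p \<in> ?C. ?x p = Some k}" for k
    by auto
  then have "(\<Prod>k\<in>UNIV. (z $ k) ^ (queue_lengths T B X t \<omega> $ k))
      = (\<Prod>k\<in>UNIV. (z $ k) ^ card {p \<in> ?C. ?x p = Some k})"
    by (simp only: queue_lengths_def vec_lambda_beta)
  also have "\<dots> = (\<Prod>k\<in>UNIV. \<Prod>p\<in>?C. if ?x p = Some k then z $ k else 1)"
    using fin by (intro prod.cong refl power_card_filter) auto
  also have "\<dots> = (\<Prod>p\<in>?C. weight z (?x p))"
    unfolding weight_eq_prod by (rule prod.swap)
  also have "\<dots> = (\<Prod>i\<in>?I. \<Prod>j\<in>UNIV. \<Prod>l<B i \<omega> $ j. weight z (X i j l \<omega> (t - T i \<omega>)))"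
    using fin by (simp add: prod.Sigma split_beta)
  finally show ?thesis by (simp add: batch_weight_def)
qed

text \<open>
  The generating function of a compound Poisson law: the product over all customers is the
  product over batches of \<open>batch_weight\<close>, each may be replaced by its conditional expectation
  given the arrival time, and the generating functional of the Poisson process gives the
  exponential. Reversing time in the integral turns arrival times into ages.
\<close>

lemma queue_lengths_pgf:
  assumes z: "z \<in> unit_cube"
  shows "expectation (\<lambda>\<omega>. \<Prod>k\<in>UNIV. (z $ k) ^ (queue_lengths T B X t \<omega> $ k))
    = exp (- (lam * (LBINT \<tau>:{0..t}. 1 - batch_pgf z \<tau>)))"
proof -
  let ?h = "\<lambda>s. batch_pgf z (max 0 (t - s))"
  let ?W = "\<lambda>n \<omega>. \<Prod>i<n. if T i \<omega> \<le> t then batch_weight z i (max 0 (t - T i \<omega>)) \<omega> else 1"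
  have fin: "AE \<omega> in M. finite {i. T i \<omega> \<le> t}"
    using arrivals[unfolded poisson_points_def, THEN conjunct2, THEN conjunct2, THEN conjunct1]
    by eventually_elim blast
  have [measurable]: "(\<lambda>\<omega>. batch_weight z i (max 0 (t - T i \<omega>)) \<omega>) \<in> borel_measurable M" for i
    by (rule batch_weight_measurable[where K = UNIV]) (auto simp: measurable_joint)
  have "(\<lambda>n. expectation (?W n)) \<longlonglongrightarrow> expectation (\<lambda>\<omega>. \<Prod>k\<in>UNIV. (z $ k) ^ (queue_lengths T B X t \<omega> $ k))"
  proof (rule integral_dominated_convergence[where w = "\<lambda>_. 1"])
    show "AE \<omega> in M. (\<lambda>n. ?W n \<omega>) \<longlonglongrightarrow> (\<Prod>k\<in>UNIV. (z $ k) ^ (queue_lengths T B X t \<omega> $ k))"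
      using fin
    proof eventually_elim
      case (elim \<omega>)
      then obtain N where N: "{i. T i \<omega> \<le> t} \<subseteq> {..<N}" by (metis finite_nat_iff_bounded)
      have "?W n \<omega> = (\<Prod>k\<in>UNIV. (z $ k) ^ (queue_lengths T B X t \<omega> $ k))" if "N \<le> n" for n
        unfolding prod_queue_lengths[OF elim]
        using N that by (intro prod.mono_neutral_cong_right) auto
      then show ?case by (intro tendsto_eventually) (auto simp: eventually_sequentially)
    qed
    show "AE \<omega> in M. norm (?W n \<omega>) \<le> 1" for n
      using batch_weight_range[OF z] by (intro AE_I2) (auto simp: abs_prod intro!: prod_le_1)
    show "(\<lambda>\<omega>. \<Prod>k\<in>UNIV. (z $ k) ^ (queue_lengths T B X t \<omega> $ k)) \<in> borel_measurable M"
      by (rule measurable_compose[OF queue_lengths_measurable]) simp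
  qed measurable
  moreover have "(\<lambda>n. expectation (?W n)) \<longlonglongrightarrow> exp (- (lam * (LBINT s:{0..t}. 1 - ?h s)))"
    unfolding expectation_all_batches[OF z]
    by (rule poisson_functional[OF arrivals]) (auto intro!: batch_pgf_measurable batch_pgf_range z)
  ultimately have "expectation (\<lambda>\<omega>. \<Prod>k\<in>UNIV. (z $ k) ^ (queue_lengths T B X t \<omega> $ k))
      = exp (- (lam * (LBINT s:{0..t}. 1 - ?h s)))"
    by (rule LIMSEQ_unique)
  also have "(LBINT s:{0..t}. 1 - ?h s) = (LBINT \<tau>:{0..t}. 1 - batch_pgf z \<tau>)"
  proof -
    have "(LBINT \<tau>:{0..t}. 1 - batch_pgf z \<tau>)
        = (LINT s|lborel. indicator {0..t} (t + - 1 * s) *\<^sub>R (1 - batch_pgf z (t + - 1 * s)))"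
      unfolding set_lebesgue_integral_def by (subst lborel_integral_real_affine[where c = "- 1" and t = t]) simp_all
    also have "\<dots> = (LBINT s:{0..t}. 1 - ?h s)"
      unfolding set_lebesgue_integral_def
      by (intro Bochner_Integration.integral_cong refl) (auto split: split_indicator simp: max_def)
    finally show ?thesis by simp
  qed
  finally show ?thesis .
qed

section \<open>Presence time and ergodicity\<close>

text \<open>
  At \<open>z = 0\<close> the weight of a batch indicates that all its customers have left. Therefore
  \<open>1 - batch_pgf 0 \<tau>\<close> is the probability that some customer of the batch is present at age \<open>\<tau>\<close>.
\<close>

lemma batch_weight_0:
  "batch_weight 0 i \<tau> \<omega> = (if \<exists>j l. l < B i \<omega> $ j \<and> X i j l \<omega> \<tau> \<noteq> None then 0 else 1)"
proof -
  have "weight 0 x = (if x = None then 1 else 0)" for x :: "'j option"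
    by (simp add: weight_def split: option.splits)
  then show ?thesis
    by (auto simp: batch_weight_def)
qed

lemma batch_weight_0_le:
  assumes "z \<in> unit_cube"
  shows "batch_weight 0 i \<tau> \<omega> \<le> batch_weight z i \<tau> \<omega>"
proof (cases "\<exists>j l. l < B i \<omega> $ j \<and> X i j l \<omega> \<tau> \<noteq> None")
  case True
  then show ?thesis using batch_weight_range(1)[OF assms] by (simp only: batch_weight_0 if_True)
next
  case False
  then have "batch_weight z i \<tau> \<omega> = 1"
    by (auto simp: batch_weight_def weight_def intro!: prod.neutral split: option.splits)
  then show ?thesis by (simp add: batch_weight_0)
qed

text \<open>
  Each present customer contributes a factor 1/2. This bounds the generating function at
  \<open>z = 1/2\<close> in terms of presence alone, so that long presence forces the generating function of
  the queue lengths to vanish in the limit.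
\<close>

lemma batch_weight_half_le:
  "batch_weight (\<chi> k. 1 / 2) i \<tau> \<omega> \<le> (1 + batch_weight 0 i \<tau> \<omega>) / 2"
proof (cases "\<exists>j l. l < B i \<omega> $ j \<and> X i j l \<omega> \<tau> \<noteq> None")
  case True
  then obtain j l where jl: "l < B i \<omega> $ j" "X i j l \<omega> \<tau> \<noteq> None" by blast
  let ?z = "(\<chi> k. 1 / 2) :: real ^ 'j"
  let ?I = "SIGMA j:(UNIV :: 'j set). {..<B i \<omega> $ j}"
  let ?w = "\<lambda>(j, l). weight ?z (X i j l \<omega> \<tau>)"
  have z: "?z \<in> unit_cube" by (simp add: unit_cube_def)
  have "batch_weight ?z i \<tau> \<omega> = (\<Prod>p\<in>?I. ?w p)"
    by (simp add: batch_weight_def prod.Sigma)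
  also have "\<dots> = ?w (j, l) * (\<Prod>p\<in>?I - {(j, l)}. ?w p)"
    using jl by (intro prod.remove) auto
  also have "\<dots> \<le> ?w (j, l) * 1"
    using weight_range[OF z] by (intro mult_left_mono prod_le_1) auto
  also have "?w (j, l) = 1 / 2" using jl by (auto simp: weight_def)
  finally show ?thesis using batch_weight_range(1)[of 0 i \<tau> \<omega>] by (simp add: unit_cube_def)
next
  case False
  then show ?thesis
    using batch_weight_range(2)[of "\<chi> k. 1 / 2" i \<tau> \<omega>]
    by (simp only: batch_weight_0 if_False) (simp add: unit_cube_def)
qed

lemma zero_in_unit_cube: "0 \<in> unit_cube"
  by (simp add: unit_cube_def)

lemma batch_pgf_0_le:
  assumes "z \<in> unit_cube" "0 \<le> \<tau>"
  shows "batch_pgf 0 \<tau> \<le> batch_pgf z \<tau>"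
  unfolding expectation_batch_weight[OF assms, of 0, symmetric]
    expectation_batch_weight[OF zero_in_unit_cube assms(2), of 0, symmetric]
  using assms zero_in_unit_cube by (intro integral_mono batch_weight_integrable batch_weight_0_le)

lemma batch_pgf_half_le:
  assumes "0 \<le> \<tau>"
  shows "batch_pgf (\<chi> k. 1 / 2) \<tau> \<le> (1 + batch_pgf 0 \<tau>) / 2"
proof -
  have z: "(\<chi> k. 1 / 2) \<in> unit_cube" by (simp add: unit_cube_def)
  have "expectation (batch_weight (\<chi> k. 1 / 2) 0 \<tau>) \<le> expectation (\<lambda>\<omega>. (1 + batch_weight 0 0 \<tau> \<omega>) / 2)"
    using assms z zero_in_unit_cube
    by (intro integral_mono batch_weight_half_le batch_weight_integrable integrable_divide_zero
        Bochner_Integration.integrable_add) simp_all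
  also have "\<dots> = (1 + expectation (batch_weight 0 0 \<tau>)) / 2"
    using batch_weight_integrable[OF zero_in_unit_cube assms, of 0] by (simp add: prob_space)
  finally show ?thesis
    by (simp add: expectation_batch_weight z zero_in_unit_cube assms)
qed

text \<open>
  Fubini's theorem: the presence time is the integral over ages of the indicator of presence.
\<close>

lemma expected_presence_time:
  "(\<integral>\<^sup>+\<omega>. presence_time B X i \<omega> \<partial>M) = (\<integral>\<^sup>+\<tau>\<in>{0..}. ennreal (1 - batch_pgf 0 \<tau>) \<partial>lborel)"
proof -
  interpret P: pair_sigma_finite M lborel ..
  let ?g = "\<lambda>\<omega> \<tau>. ennreal (1 - batch_weight 0 i (max 0 \<tau>) \<omega>) * indicator {0..} \<tau>"
  have [measurable]: "(\<lambda>x. batch_weight 0 i (max 0 (snd x)) (fst x)) \<in> borel_measurable (M \<Otimes>\<^sub>M lborel)"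
    by (rule batch_weight_measurable[where K = UNIV])
       (auto intro: measurable_compose[OF measurable_fst measurable_joint])
  have "(\<integral>\<^sup>+\<omega>. presence_time B X i \<omega> \<partial>M) = (\<integral>\<^sup>+\<omega>. \<integral>\<^sup>+\<tau>. ?g \<omega> \<tau> \<partial>lborel \<partial>M)"
  proof (rule nn_integral_cong)
    fix \<omega> assume \<omega>: "\<omega> \<in> space M"
    let ?A = "{t. 0 \<le> t \<and> (\<exists>j l. l < B i \<omega> $ j \<and> X i j l \<omega> t \<noteq> None)}"
    have eq: "indicator ?A \<tau> = ?g \<omega> \<tau>" for \<tau>
      by (auto simp: batch_weight_0 split: split_indicator)
    have [measurable]: "(\<lambda>\<tau>. batch_weight 0 i (max 0 \<tau>) \<omega>) \<in> borel_measurable lborel"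
      using \<omega> by (intro batch_weight_measurable[where K = UNIV]) auto
    have "?A = {\<tau> \<in> space lborel. 0 \<le> \<tau> \<and> batch_weight 0 i (max 0 \<tau>) \<omega> = 0}"
      by (auto simp: batch_weight_0 max_def)
    also have "\<dots> \<in> sets lborel" by measurable
    finally show "presence_time B X i \<omega> = (\<integral>\<^sup>+\<tau>. ?g \<omega> \<tau> \<partial>lborel)"
      unfolding presence_time_def eq[symmetric] by (rule nn_integral_indicator[symmetric])
  qed
  also have "\<dots> = (\<integral>\<^sup>+\<tau>. \<integral>\<^sup>+\<omega>. ?g \<omega> \<tau> \<partial>M \<partial>lborel)"
    by (rule P.Fubini'[symmetric]) (simp add: split_beta)
  also have "\<dots> = (\<integral>\<^sup>+\<tau>\<in>{0..}. ennreal (1 - batch_pgf 0 \<tau>) \<partial>lborel)"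
  proof (rule nn_integral_cong)
    fix \<tau> :: real
    show "(\<integral>\<^sup>+\<omega>. ?g \<omega> \<tau> \<partial>M) = ennreal (1 - batch_pgf 0 \<tau>) * indicator {0..} \<tau>"
    proof (cases "0 \<le> \<tau>")
      case True
      note int = batch_weight_integrable[OF zero_in_unit_cube True, of i]
      have "(\<integral>\<^sup>+\<omega>. ennreal (1 - batch_weight 0 i \<tau> \<omega>) \<partial>M) = ennreal (expectation (\<lambda>\<omega>. 1 - batch_weight 0 i \<tau> \<omega>))"
        using int batch_weight_range(2)[OF zero_in_unit_cube] by (intro nn_integral_eq_integral) auto
      also have "expectation (\<lambda>\<omega>. 1 - batch_weight 0 i \<tau> \<omega>) = 1 - batch_pgf 0 \<tau>"
        using int by (simp add: prob_space expectation_batch_weight[OF zero_in_unit_cube True])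
      finally show ?thesis using True by simp
    qed simp
  qed
  finally show ?thesis .
qed

lemma customer_pgf_0: "customer_pgf 0 \<tau> = (\<chi> j. 1 - stay_prob q j \<tau>)"
  by (simp add: customer_pgf_def stay_prob_def)

lemma batch_pgf_tendsto_1:
  assumes "0 \<le> \<tau>"
  shows "(\<lambda>n. batch_pgf (\<chi> k. 1 - 1 / real (Suc n)) \<tau>) \<longlonglongrightarrow> 1"
proof -
  let ?z = "\<lambda>n. (\<chi> k. 1 - 1 / real (Suc n)) :: real ^ 'j"
  have z: "?z n \<in> unit_cube" for n by (simp add: unit_cube_def)
  have "(\<lambda>n. expectation (batch_weight (?z n) 0 \<tau>)) \<longlonglongrightarrow> expectation (\<lambda>_. 1)"
  proof (rule integral_dominated_convergence[where w = "\<lambda>_. 1"])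
    show "AE \<omega> in M. (\<lambda>n. batch_weight (?z n) 0 \<tau> \<omega>) \<longlonglongrightarrow> 1"
    proof (rule AE_I2)
      fix \<omega>
      have "(\<lambda>n. 1 - 1 / real (Suc n)) \<longlonglongrightarrow> 1 - 0"
        by (intro tendsto_intros LIMSEQ_Suc lim_const_over_n)
      then have "(\<lambda>n. weight (?z n) x) \<longlonglongrightarrow> 1" for x
        by (cases x) (simp_all add: weight_def)
      then have "(\<lambda>n. batch_weight (?z n) 0 \<tau> \<omega>) \<longlonglongrightarrow> (\<Prod>j\<in>(UNIV :: 'j set). \<Prod>l<B 0 \<omega> $ j. 1)"
        unfolding batch_weight_def by (intro tendsto_prod)
      then show "(\<lambda>n. batch_weight (?z n) 0 \<tau> \<omega>) \<longlonglongrightarrow> 1" by simp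
    qed
    show "batch_weight (?z n) 0 \<tau> \<in> borel_measurable M" for n
      using batch_weight_integrable[OF z assms] by (rule borel_measurable_integrable)
    show "AE \<omega> in M. norm (batch_weight (?z n) 0 \<tau> \<omega>) \<le> 1" for n
      using batch_weight_range[OF z] by simp
  qed simp_all
  then show ?thesis unfolding expectation_batch_weight[OF z assms] by (simp add: prob_space)
qed

text \<open>
  The exponents \<open>\<integral> (1 - batch_pgf z)\<close> over \<open>[0, t]\<close> converge as \<open>t\<close> grows, since their
  integrands are dominated by that for \<open>z = 0\<close>, which is integrable over the half-line. By
  dominated convergence once more, the limit exponent tends to 0 as \<open>z\<close> tends to 1 along the
  diagonal, and the continuity theorem gives a proper limit law.
\<close>

lemma ergodic_if_finite:
  assumes fin: "(\<integral>\<^sup>+\<tau>\<in>{0..}. ennreal (1 - batch_pgf 0 \<tau>) \<partial>lborel) < \<infinity>"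
  shows "ergodic M T B X"
proof -
  let ?w = "\<lambda>z \<tau>. indicator {0..} \<tau> *\<^sub>R (1 - batch_pgf z \<tau>)"
  define F where "F z = exp (- (lam * (LBINT \<tau>:{0..}. 1 - batch_pgf z \<tau>)))" for z
  have w_measurable: "?w z \<in> borel_measurable lborel" if "z \<in> unit_cube" for z
  proof -
    have "(\<lambda>\<tau>. indicator {0..} \<tau> *\<^sub>R (1 - batch_pgf z (max 0 \<tau>))) \<in> borel_measurable lborel"
      using that by (intro borel_measurable_scaleR borel_measurable_diff batch_pgf_measurable) auto
    then show ?thesis by (rule measurable_cong[THEN iffD1, rotated]) (auto split: split_indicator)
  qed
  have bound: "norm (?w z \<tau>) \<le> ?w 0 \<tau>" if "z \<in> unit_cube" for z \<tau>
    using batch_pgf_0_le[OF that] batch_pgf_range[OF that] by (auto split: split_indicator)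
  have int_0: "integrable lborel (?w 0)"
  proof (rule integrableI_bounded)
    have "(\<integral>\<^sup>+\<tau>. ennreal (norm (?w 0 \<tau>)) \<partial>lborel) = (\<integral>\<^sup>+\<tau>\<in>{0..}. ennreal (1 - batch_pgf 0 \<tau>) \<partial>lborel)"
      using batch_pgf_range(2)[OF zero_in_unit_cube]
      by (intro nn_integral_cong) (auto split: split_indicator)
    then show "(\<integral>\<^sup>+\<tau>. ennreal (norm (?w 0 \<tau>)) \<partial>lborel) < \<infinity>" using fin by simp
  qed (rule w_measurable[OF zero_in_unit_cube])
  have int: "set_integrable lborel {0..} (\<lambda>\<tau>. 1 - batch_pgf z \<tau>)" if "z \<in> unit_cube" for z
    unfolding set_integrable_def
    using int_0 w_measurable[OF that]
  proof (rule Bochner_Integration.integrable_bound)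
    show "AE \<tau> in lborel. norm (?w z \<tau>) \<le> norm (?w 0 \<tau>)"
      using bound[OF that] by (intro AE_I2) (metis abs_ge_self order_trans real_norm_def)
  qed
  have "\<exists>p. \<forall>f :: nat ^ 'j \<Rightarrow> real. measure_pmf.expectation p f = expectation (\<lambda>\<omega>. f (queue_lengths T B X t \<omega>))" for t
    by (rule law_pmf) measurable
  then obtain P :: "real \<Rightarrow> (nat ^ 'j) pmf" where
    P: "\<And>t f. measure_pmf.expectation (P t) f = (expectation (\<lambda>\<omega>. f (queue_lengths T B X t \<omega>)) :: real)"
    by metis
  have "\<exists>p. \<forall>f :: nat ^ 'j \<Rightarrow> real. bounded (range f) \<longrightarrow>
      ((\<lambda>t. measure_pmf.expectation (P t) f) \<longlongrightarrow> measure_pmf.expectation p f) at_top"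
  proof (rule pgf_continuity)
    fix z :: "real ^ 'j" assume "\<And>j. 0 \<le> z $ j \<and> z $ j \<le> 1"
    then have z: "z \<in> unit_cube" by (simp add: unit_cube_def)
    have "((\<lambda>t. LBINT \<tau>:{0..t}. 1 - batch_pgf z \<tau>) \<longlongrightarrow> (LBINT \<tau>:{0..}. 1 - batch_pgf z \<tau>)) at_top"
      using int[OF z] by (intro tendsto_set_lebesgue_integral_at_top) auto
    then have "((\<lambda>t. exp (- (lam * (LBINT \<tau>:{0..t}. 1 - batch_pgf z \<tau>)))) \<longlongrightarrow> F z) at_top"
      unfolding F_def by (intro tendsto_intros)
    then show "((\<lambda>t. pgf (P t) z) \<longlongrightarrow> F z) at_top"
      by (simp add: pgf_def P queue_lengths_pgf[OF z])
  next
    fix e :: real assume "0 < e"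
    let ?z = "\<lambda>n. (\<chi> k. 1 - 1 / real (Suc n)) :: real ^ 'j"
    have z: "?z n \<in> unit_cube" for n by (simp add: unit_cube_def)
    have "(\<lambda>n. LBINT \<tau>:{0..}. 1 - batch_pgf (?z n) \<tau>) \<longlonglongrightarrow> (LBINT \<tau>:{0..} :: real set. 0)"
      unfolding set_lebesgue_integral_def
    proof (rule integral_dominated_convergence[where w = "?w 0"])
      show "AE \<tau> in lborel. (\<lambda>n. ?w (?z n) \<tau>) \<longlonglongrightarrow> indicator {0..} \<tau> *\<^sub>R (0 :: real)"
      proof (rule AE_I2)
        fix \<tau> :: real
        show "(\<lambda>n. ?w (?z n) \<tau>) \<longlonglongrightarrow> indicator {0..} \<tau> *\<^sub>R (0 :: real)"
        proof (cases "0 \<le> \<tau>")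
          case True
          have "(\<lambda>n. ?w (?z n) \<tau>) \<longlonglongrightarrow> indicator {0..} \<tau> *\<^sub>R (1 - 1)"
            by (intro tendsto_intros batch_pgf_tendsto_1 True)
          then show ?thesis by simp
        qed simp
      qed
      show "AE \<tau> in lborel. norm (?w (?z n) \<tau>) \<le> ?w 0 \<tau>" for n
        by (intro AE_I2 bound z)
      show "?w (?z n) \<in> borel_measurable lborel" for n
        by (rule w_measurable[OF z])
    qed (use int_0 in simp_all)
    then have "(\<lambda>n. F (?z n)) \<longlonglongrightarrow> exp (- (lam * 0))"
      unfolding F_def by (intro tendsto_intros) (simp add: set_lebesgue_integral_def)
    then have "eventually (\<lambda>n. 1 - e < F (?z n)) sequentially"
      using \<open>0 < e\<close> by (intro order_tendstoD(1)) auto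
    then obtain n where "1 - e < F (?z n)" by (auto simp: eventually_sequentially)
    then show "\<exists>u. 0 \<le> u \<and> u < 1 \<and> 1 - e < F (\<chi> j. u)"
      by (intro exI[of _ "1 - 1 / real (Suc n)"]) auto
  qed simp
  then show ?thesis
    unfolding ergodic_def converges_in_distribution_def P by blast
qed

text \<open>
  Some state \<open>n\<close> has positive limit probability. Then the generating function of the queue
  lengths at \<open>z = 1/2\<close> is at least \<open>2 ^ (- \<Sum>k. n k)\<close> times half this probability for all large
  times. Its exponent is therefore bounded, and with it the integral of the presence
  probability.
\<close>

lemma finite_if_ergodic:
  assumes "ergodic M T B X"
  shows "(\<integral>\<^sup>+\<tau>\<in>{0..}. ennreal (1 - batch_pgf 0 \<tau>) \<partial>lborel) < \<infinity>"
proof -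
  let ?z = "(\<chi> k. 1 / 2) :: real ^ 'j"
  have z: "?z \<in> unit_cube" by (simp add: unit_cube_def)
  define a where "a t = (LBINT \<tau>:{0..t}. 1 - batch_pgf 0 \<tau>)" for t
  have int: "set_integrable lborel {0..t} (\<lambda>\<tau>. 1 - batch_pgf y \<tau>)" if y: "y \<in> unit_cube" for y and t :: real
    unfolding set_integrable_def
  proof (rule Bochner_Integration.integrable_bound[where f = "indicator {0..t} :: real \<Rightarrow> real"])
    have "(\<lambda>\<tau>. indicator {0..t} \<tau> *\<^sub>R (1 - batch_pgf y (max 0 \<tau>))) \<in> borel_measurable lborel"
      using y by (intro borel_measurable_scaleR borel_measurable_diff batch_pgf_measurable) auto
    then show "(\<lambda>\<tau>. indicator {0..t} \<tau> *\<^sub>R (1 - batch_pgf y \<tau>)) \<in> borel_measurable lborel"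
      by (rule measurable_cong[THEN iffD1, rotated]) (auto split: split_indicator)
    show "AE \<tau> in lborel. norm (indicator {0..t} \<tau> *\<^sub>R (1 - batch_pgf y \<tau>)) \<le> norm (indicator {0..t} \<tau> :: real)"
      using batch_pgf_range[OF y] by (intro AE_I2) (auto split: split_indicator)
  qed (simp add: emeasure_lborel_Icc_eq)
  have a_half: "a t / 2 \<le> (LBINT \<tau>:{0..t}. 1 - batch_pgf ?z \<tau>)" for t
  proof -
    have "a t / 2 = (LBINT \<tau>:{0..t}. (1 - batch_pgf 0 \<tau>) / 2)" by (simp add: a_def)
    also have "\<dots> \<le> (LBINT \<tau>:{0..t}. 1 - batch_pgf ?z \<tau>)"
    proof (rule set_integral_mono)
      show "(1 - batch_pgf 0 \<tau>) / 2 \<le> 1 - batch_pgf ?z \<tau>" if "\<tau> \<in> {0..t}" for \<tau>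
        using batch_pgf_half_le[of \<tau>] that by (simp add: field_simps)
    qed (use int[OF z] int[OF zero_in_unit_cube] in auto)
    finally show ?thesis .
  qed
  from assms obtain p :: "(nat ^ 'j) pmf" where
    p: "converges_in_distribution M (queue_lengths T B X) (measure_pmf p)"
    unfolding ergodic_def by blast
  obtain n where "n \<in> set_pmf p" using set_pmf_not_empty[of p] by blast
  then have pos: "0 < pmf p n" by (simp add: pmf_positive)
  have "((\<lambda>t. expectation (\<lambda>\<omega>. indicat_real {n} (queue_lengths T B X t \<omega>))) \<longlongrightarrow>
      measure_pmf.expectation p (indicator {n} :: _ \<Rightarrow> real)) at_top"
  proof -
    have "continuous_on UNIV (indicator {n} :: nat ^ 'j \<Rightarrow> real)"
      by (simp add: continuous_on_open_vimage open_discrete_vec)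
    moreover have "bounded (range (indicator {n} :: nat ^ 'j \<Rightarrow> real))"
      by (intro boundedI[of _ 1]) (auto split: split_indicator)
    ultimately show ?thesis using p unfolding converges_in_distribution_def by blast
  qed
  moreover have "measure_pmf.expectation p (indicator {n} :: _ \<Rightarrow> real) = pmf p n"
    by (simp add: pmf.rep_eq)
  ultimately have "eventually (\<lambda>t. pmf p n / 2 < expectation (\<lambda>\<omega>. indicat_real {n} (queue_lengths T B X t \<omega>))) at_top"
    using pos by (intro order_tendstoD(1)) auto
  then obtain t0 where t0: "\<And>t. t0 \<le> t \<Longrightarrow> pmf p n / 2 < expectation (\<lambda>\<omega>. indicat_real {n} (queue_lengths T B X t \<omega>))"
    by (auto simp: eventually_at_top_linorder)
  \<comment> \<open>A lower bound for the generating function at \<open>z = 1/2\<close>, uniform in large \<open>t\<close>.\<close>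
  define c where "c = (1 / 2) ^ (\<Sum>k\<in>UNIV. n $ k) * (pmf p n / 2)"
  have "0 < c" using pos by (simp add: c_def)
  have a_bound: "a t \<le> 2 * (- ln c) / lam" if "t0 \<le> t" for t
  proof -
    have "c \<le> (1 / 2) ^ (\<Sum>k\<in>UNIV. n $ k) * expectation (\<lambda>\<omega>. indicat_real {n} (queue_lengths T B X t \<omega>))"
      unfolding c_def using t0[OF that] by (intro mult_left_mono) auto
    also have "\<dots> = expectation (\<lambda>\<omega>. (1 / 2) ^ (\<Sum>k\<in>UNIV. n $ k) * indicat_real {n} (queue_lengths T B X t \<omega>))"
      by simp
    also have "\<dots> \<le> expectation (\<lambda>\<omega>. \<Prod>k\<in>UNIV. (?z $ k) ^ (queue_lengths T B X t \<omega> $ k))"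
    proof (rule integral_mono)
      have meas: "(\<lambda>\<omega>. f (queue_lengths T B X t \<omega>)) \<in> borel_measurable M" for f :: "nat ^ 'j \<Rightarrow> real"
        by (rule measurable_compose[OF queue_lengths_measurable]) simp
      show "integrable M (\<lambda>\<omega>. (1 / 2 :: real) ^ (\<Sum>k\<in>UNIV. n $ k) * indicat_real {n} (queue_lengths T B X t \<omega>))"
        by (intro integrable_mult_right integrable_const_bound[where B = 1] meas) (auto split: split_indicator)
      show "integrable M (\<lambda>\<omega>. \<Prod>k\<in>UNIV. (?z $ k) ^ (queue_lengths T B X t \<omega> $ k))"
        by (intro integrable_const_bound[where B = 1] meas) (auto simp: abs_prod power_le_one intro!: prod_le_1)
      show "(1 / 2 :: real) ^ (\<Sum>k\<in>UNIV. n $ k) * indicat_real {n} (queue_lengths T B X t \<omega>)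
          \<le> (\<Prod>k\<in>UNIV. (?z $ k) ^ (queue_lengths T B X t \<omega> $ k))" for \<omega>
        by (auto simp: power_sum prod_nonneg split: split_indicator)
    qed
    also have "\<dots> = exp (- (lam * (LBINT \<tau>:{0..t}. 1 - batch_pgf ?z \<tau>)))"
      by (rule queue_lengths_pgf[OF z])
    also have "\<dots> \<le> exp (- (lam * (a t / 2)))"
      using a_half[of t] rate_pos by simp
    finally have "ln c \<le> ln (exp (- (lam * (a t / 2))))"
      using \<open>0 < c\<close> by (simp only: ln_le_cancel_iff exp_gt_zero)
    then have "a t * lam \<le> 2 * (- ln c)" by (simp add: mult.commute)
    then show ?thesis using rate_pos by (simp only: pos_le_divide_eq)
  qed
  \<comment> \<open>The bound passes to the half-line by monotone convergence along integer times.\<close>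
  let ?g = "\<lambda>m \<tau>. ennreal (1 - batch_pgf 0 \<tau>) * indicator {0..real m} \<tau>"
  have g: "(\<integral>\<^sup>+\<tau>. ?g m \<tau> \<partial>lborel) = ennreal (a (real m))" for m
  proof -
    have "(\<integral>\<^sup>+\<tau>. ?g m \<tau> \<partial>lborel) = (\<integral>\<^sup>+\<tau>. ennreal (indicator {0..real m} \<tau> *\<^sub>R (1 - batch_pgf 0 \<tau>)) \<partial>lborel)"
      by (intro nn_integral_cong) (auto split: split_indicator)
    also have "\<dots> = ennreal (a (real m))"
      unfolding a_def set_lebesgue_integral_def
      using int[OF zero_in_unit_cube, of "real m"] batch_pgf_range(2)[OF zero_in_unit_cube]
      by (intro nn_integral_eq_integral) (auto simp: set_integrable_def split: split_indicator)
    finally show ?thesis .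
  qed
  have mono: "incseq ?g"
    by (auto simp: incseq_def le_fun_def split: split_indicator)
  have "(\<integral>\<^sup>+\<tau>\<in>{0..}. ennreal (1 - batch_pgf 0 \<tau>) \<partial>lborel) = (\<integral>\<^sup>+\<tau>. (SUP m. ?g m \<tau>) \<partial>lborel)"
  proof (rule nn_integral_cong)
    fix \<tau> :: real
    obtain m where m: "\<tau> \<le> real m" using real_arch_simple by blast
    show "ennreal (1 - batch_pgf 0 \<tau>) * indicator {0..} \<tau> = (SUP m. ?g m \<tau>)"
    proof (rule antisym)
      show "ennreal (1 - batch_pgf 0 \<tau>) * indicator {0..} \<tau> \<le> (SUP m. ?g m \<tau>)"
        using m by (intro SUP_upper2[of m]) (auto split: split_indicator)
      show "(SUP m. ?g m \<tau>) \<le> ennreal (1 - batch_pgf 0 \<tau>) * indicator {0..} \<tau>"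
        by (intro SUP_least) (auto split: split_indicator)
    qed
  qed
  also have "\<dots> = (SUP m. \<integral>\<^sup>+\<tau>. ?g m \<tau> \<partial>lborel)"
  proof (rule nn_integral_monotone_convergence_SUP[OF mono])
    fix m
    have "(\<lambda>\<tau>. ennreal (1 - batch_pgf 0 (max 0 \<tau>)) * indicator {0..real m} \<tau>) \<in> borel_measurable lborel"
    proof -
      have [measurable]: "(\<lambda>\<tau>. batch_pgf 0 (max 0 \<tau>)) \<in> borel_measurable lborel"
        using zero_in_unit_cube by (intro batch_pgf_measurable) auto
      show ?thesis by measurable
    qed
    then show "?g m \<in> borel_measurable lborel"
      by (rule measurable_cong[THEN iffD1, rotated]) (auto split: split_indicator)
  qed
  also have "\<dots> \<le> ennreal (2 * (- ln c) / lam)"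
  proof (rule SUP_least)
    fix m
    obtain m' where m': "t0 \<le> real m'" using real_arch_simple by blast
    have "(\<integral>\<^sup>+\<tau>. ?g m \<tau> \<partial>lborel) \<le> (\<integral>\<^sup>+\<tau>. ?g (max m m') \<tau> \<partial>lborel)"
      using mono by (intro nn_integral_mono) (auto simp: incseq_def le_fun_def)
    also have "\<dots> = ennreal (a (real (max m m')))" by (rule g)
    also have "\<dots> \<le> ennreal (2 * (- ln c) / lam)"
      using m' by (intro ennreal_leI a_bound) auto
    finally show "(\<integral>\<^sup>+\<tau>. ?g m \<tau> \<partial>lborel) \<le> ennreal (2 * (- ln c) / lam)" .
  qed
  also have "\<dots> < \<infinity>" by simp
  finally show ?thesis .
qed

end

theorem theorem4p1:
  fixes M :: "'a measure"
    and lam :: real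
    and T :: "nat \<Rightarrow> 'a \<Rightarrow> real"
    and S :: "(nat ^ 'j::finite) pmf"
    and B :: "nat \<Rightarrow> 'a \<Rightarrow> nat ^ 'j"
    and X :: "nat \<Rightarrow> 'j \<Rightarrow> nat \<Rightarrow> 'a \<Rightarrow> real \<Rightarrow> 'j option"
    and q :: "'j \<Rightarrow> 'j \<Rightarrow> real \<Rightarrow> real"
    and i :: nat
  assumes "batch_network M lam T S B X q"
  shows "(ergodic M T B X \<longleftrightarrow> (\<integral>\<^sup>+\<omega>. presence_time B X i \<omega> \<partial>M) < \<infinity>) \<and>
         (\<integral>\<^sup>+\<omega>. presence_time B X i \<omega> \<partial>M)
           = (\<integral>\<^sup>+\<tau>\<in>{0..}. ennreal (1 - pgf S (\<chi> j. 1 - stay_prob q j \<tau>)) \<partial>lborel)"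
proof -
  interpret batch_network M lam T S B X q by fact
  have presence: "(\<integral>\<^sup>+\<omega>. presence_time B X i \<omega> \<partial>M)
      = (\<integral>\<^sup>+\<tau>\<in>{0..}. ennreal (1 - batch_pgf 0 \<tau>) \<partial>lborel)"
    by (rule expected_presence_time)
  have "ergodic M T B X \<longleftrightarrow> (\<integral>\<^sup>+\<omega>. presence_time B X i \<omega> \<partial>M) < \<infinity>"
    unfolding presence using ergodic_if_finite finite_if_ergodic by blast
  then show ?thesis
    unfolding presence batch_pgf_def customer_pgf_0 by simp
qed

end
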